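(* Suppose that $f \in \mathcal{A}$ (the MacLane class) and that the set $CV(f)$ of critical values of $f$ is bounded. Then $f$ has no global tracts.
   Context: $\mathbb{D}=\{z\in\mathbb{C}:|z|<1\}$ and $\widehat{\mathbb{C}}=\mathbb{C}\cup\{\infty\}$. A boundary path is a path $\Gamma:[0,1)\to\mathbb{D}$ with $|\Gamma(t)|\to 1$ as $t\to 1$; its end is the set $\overline{\Gamma}\cap\partial\mathbb{D}$. A holomorphic function $f$ in $\mathbb{D}$ has asymptotic value $a\in\widehat{\mathbb{C}}$ at $\zeta\in\partial\mathbb{D}$ if there is a boundary path $\Gamma$ with end $\{\zeta\}$ and $f(\Gamma(t))\to a$ as $t\to1$. The MacLane class $\mathcal{A}$ is the set of functions holomorphic and non-constant in $\mathbb{D}$ that have asymptotic values (in $\widehat{\mathbb{C}}$) at points of a dense subset of $\partial\mathbb{D}$. $CV(f)=\{f(z): z\in\mathbb{D},\ f'(z)=0\}$. Tracts: let $d$ be the chordal metric on $\widehat{\mathbb{C}}$ and $U(a,\epsilon)=\{z\in\widehat{\mathbb{C}}: d(a,z)<\epsilon\}$. Suppose $a\in\widehat{\mathbb{C}}$ and to each $\epsilon>0$ there is a component $D(\epsilon)$ of $f^{-1}(U(a,\epsilon))$ such that $D(\epsilon_1)\subset D(\epsilon_2)$ for $0<\epsilon_1<\epsilon_2$ and $\bigcap_{\epsilon>0}D(\epsilon)=\emptyset$. Then the pair $\{D(\epsilon),a\}$ is a tract of $f$ over $a$, with end $K=\bigcap_{\epsilon>0}\overline{D(\epsilon)}$.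 The tract is a global tract if $K=\partial\mathbb{D}$ and for each arc $\gamma\subset\partial\mathbb{D}$ there is a sequence of arcs $\gamma_n\subset D(1/n)$ which tend to $\gamma$. *)

theory Defs
  imports "HOL-Complex_Analysis.Complex_Analysis"
begin

abbreviation unit_disc :: "complex set"
  where "unit_disc \<equiv> ball 0 1"

abbreviation unit_circle :: "complex set"
  where "unit_circle \<equiv> sphere 0 1"

(* The extended plane is complex option, with None for the point at infinity. *)
type_synonym extended_complex = "complex option"

(* Euclidean distance in R^3 of the stereographic projections to the unit sphere *)
fun chordal_dist :: "extended_complex \<Rightarrow> extended_complex \<Rightarrow> real" where
  "chordal_dist (Some z) (Some w) =
     2 * cmod (z - w) / (sqrt (1 + (cmod z)\<^sup>2) * sqrt (1 + (cmod w)\<^sup>2))"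
| "chordal_dist (Some z) None = 2 / sqrt (1 + (cmod z)\<^sup>2)"
| "chordal_dist None (Some w) = 2 / sqrt (1 + (cmod w)\<^sup>2)"
| "chordal_dist None None = 0"

definition chordal_ball :: "extended_complex \<Rightarrow> real \<Rightarrow> extended_complex set" where
  "chordal_ball a \<epsilon> = {z. chordal_dist a z < \<epsilon>}"

definition boundary_path :: "(real \<Rightarrow> complex) \<Rightarrow> bool" where
  "boundary_path \<Gamma> \<longleftrightarrow>
     continuous_on {0..<1} \<Gamma> \<and> \<Gamma> ` {0..<1} \<subseteq> unit_disc \<and>
     ((\<lambda>t. cmod (\<Gamma> t)) \<longlongrightarrow> 1) (at_left 1)"

definition path_end :: "(real \<Rightarrow> complex) \<Rightarrow> complex set" where
  "path_end \<Gamma> = closure (\<Gamma> ` {0..<1}) \<inter> unit_circle"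

definition has_asymptotic_value ::
    "(complex \<Rightarrow> complex) \<Rightarrow> complex \<Rightarrow> extended_complex \<Rightarrow> bool" where
  "has_asymptotic_value f \<zeta> a \<longleftrightarrow>
     (\<exists>\<Gamma>. boundary_path \<Gamma> \<and> path_end \<Gamma> = {\<zeta>} \<and>
          ((\<lambda>t. chordal_dist (Some (f (\<Gamma> t))) a) \<longlongrightarrow> 0) (at_left 1))"

(* Values of f outside the unit disc are irrelevant throughout. *)
definition MacLane_class :: "(complex \<Rightarrow> complex) set" where
  "MacLane_class = {f. f holomorphic_on unit_disc \<and> \<not> f constant_on unit_disc \<and>
     unit_circle \<subseteq> closure {\<zeta> \<in> unit_circle. \<exists>a. has_asymptotic_value f \<zeta> a}}"

definition critical_values :: "(complex \<Rightarrow> complex) \<Rightarrow> complex set" where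
  "critical_values f = {f z | z. z \<in> unit_disc \<and> deriv f z = 0}"

(* Only the values of D at positive reals matter. *)
definition is_tract ::
    "(complex \<Rightarrow> complex) \<Rightarrow> (real \<Rightarrow> complex set) \<Rightarrow> extended_complex \<Rightarrow> bool" where
  "is_tract f D a \<longleftrightarrow>
     (\<forall>\<epsilon>>0. D \<epsilon> \<in> components {z \<in> unit_disc. Some (f z) \<in> chordal_ball a \<epsilon>}) \<and>
     (\<forall>\<epsilon>\<^sub>1 \<epsilon>\<^sub>2. 0 < \<epsilon>\<^sub>1 \<and> \<epsilon>\<^sub>1 < \<epsilon>\<^sub>2 \<longrightarrow> D \<epsilon>\<^sub>1 \<subseteq> D \<epsilon>\<^sub>2) \<and>
     (\<Inter>\<epsilon>\<in>{0<..}. D \<epsilon>) = {}"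

definition tract_end :: "(real \<Rightarrow> complex set) \<Rightarrow> complex set" where
  "tract_end D = (\<Inter>\<epsilon>\<in>{0<..}. closure (D \<epsilon>))"

(* Convergence with respect to the Hausdorff distance: eventually each of the two sets lies in
   the \<epsilon>-neighbourhood of the other. *)
definition sets_tend_to :: "(nat \<Rightarrow> complex set) \<Rightarrow> complex set \<Rightarrow> bool" where
  "sets_tend_to S T \<longleftrightarrow>
     (\<forall>\<epsilon>>0. \<forall>\<^sub>F n in sequentially.
        (\<forall>z\<in>S n. \<exists>w\<in>T. dist z w < \<epsilon>) \<and> (\<forall>w\<in>T. \<exists>z\<in>S n. dist z w < \<epsilon>))"

(* Arcs are closed and nondegenerate (images of injective paths). An arc of the circle is
   therefore a proper closed subarc. The index starts at n = 1, where 1/n makes sense. *)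
definition is_global_tract ::
    "(complex \<Rightarrow> complex) \<Rightarrow> (real \<Rightarrow> complex set) \<Rightarrow> extended_complex \<Rightarrow> bool" where
  "is_global_tract f D a \<longleftrightarrow>
     is_tract f D a \<and> tract_end D = unit_circle \<and>
     (\<forall>\<gamma>. arc \<gamma> \<and> path_image \<gamma> \<subseteq> unit_circle \<longrightarrow>
        (\<exists>\<gamma>s :: nat \<Rightarrow> real \<Rightarrow> complex.
           (\<forall>n\<ge>1. arc (\<gamma>s n) \<and> path_image (\<gamma>s n) \<subseteq> D (1 / real n)) \<and>
           sets_tend_to (\<lambda>n. path_image (\<gamma>s n)) (path_image \<gamma>)))"

end

theory Submission
  imports Defs
begin

text \<open>Let \<open>D\<close> be a global tract over \<open>a\<close>. A path ending at a point of the circle along which \<open>f\<close> has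
  an asymptotic value must cross the arcs in \<open>D (1/n)\<close> that tend to a neighbourhood of that point, so
  this value is \<open>a\<close>. Two such paths, ending near \<open>\<i>\<close> and \<open>-\<i>\<close>, connect arcs of \<open>D (1/n)\<close> near the right
  and the left part of the circle to a loop that winds once around the origin, is as close to the
  circle as we like, and on which \<open>f\<close> is as close to \<open>a\<close> as we like.

  If \<open>a\<close> is finite, the maximum principle inside the loops gives \<open>f = a\<close>. If \<open>a = \<infinity>\<close>, every
  connected subset of a sublevel set of \<open>|f|\<close> is trapped inside a loop, hence is relatively compact in
  the disc. Two components of a sublevel set can only merge, as the level grows, at a critical point.
  So all sublevel sets above the critical values are connected, hence relatively compact, and
  \<open>|f| \<rightarrow> \<infinity>\<close> at the circle. This is impossible: after division by its finitely many zeros, \<open>1/f\<close>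
  would violate the maximum principle.\<close>

section \<open>Crossing paths and winding numbers\<close>

text \<open>Transfer of \<open>fashoda\<close> from \<open>real^2\<close>: the coordinate map
  \<open>v\<close> is continuous and injective and takes subsets of a box into the corresponding
  box, so a common point of the images is the image of a common point.\<close>

lemma fashoda_complex:
  fixes p q :: "real \<Rightarrow> complex"
  assumes "path p" "path q" "path_image p \<subseteq> cbox a b" "path_image q \<subseteq> cbox a b"
    and "Re (pathstart p) = Re a" "Re (pathfinish p) = Re b"
    and "Im (pathstart q) = Im a" "Im (pathfinish q) = Im b"
  shows "path_image p \<inter> path_image q \<noteq> {}"
proof -
  define v :: "complex \<Rightarrow> real^2" where "v = (\<lambda>z. vector [Re z, Im z])"
  have v_nth: "v z $ 1 = Re z" "v z $ 2 = Im z" for z by (simp_all add: v_def)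
  have inj: "v z = v w \<Longrightarrow> z = w" for z w using v_nth complex_eqI by metis
  have "continuous_on UNIV (\<lambda>z. (\<chi> i. v z $ i))"
  proof (rule continuous_on_vec_lambda)
    show "continuous_on UNIV (\<lambda>z. v z $ i)" for i
      using exhaust_2[of i]
      by (metis (no_types, lifting) ext v_nth continuous_on_Re continuous_on_Im continuous_on_id)
  qed
  then have contv: "continuous_on S v" for S
    using continuous_on_subset by (simp add: vec_lambda_eta) blast
  have box: "v ` S \<subseteq> cbox (v a) (v b)" if "S \<subseteq> cbox a b" for S
    using that by (force simp: mem_box_cart forall_2 v_nth in_cbox_complex_iff)
  obtain z where "z \<in> path_image (v \<circ> p)" "z \<in> path_image (v \<circ> q)"
    by (rule fashoda[of "v \<circ> p" "v \<circ> q" "v a" "v b"])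
       (use assms contv box in \<open>auto simp: path_continuous_image path_image_compose
          pathstart_compose pathfinish_compose v_nth\<close>)
  then show ?thesis
    using inj by (auto simp: path_image_compose)
qed

text \<open>In a large box \<open>p\<close> is prolonged by horizontal segments to the left and
  right sides and \<open>q\<close> by vertical segments to the bottom and top. The strict
  inequalities keep the added segments away from the other path and from each other, so the meeting
  point lies on \<open>p\<close> and \<open>q\<close> themselves.\<close>

lemma crossing_paths_meet:
  fixes p q :: "real \<Rightarrow> complex"
  assumes p: "path p" and q: "path q"
    and Re: "\<And>z. z \<in> path_image q \<Longrightarrow> Re (pathstart p) < Re z \<and> Re z < Re (pathfinish p)"
    and Im: "\<And>z. z \<in> path_image p \<Longrightarrow> Im (pathstart q) < Im z \<and> Im z < Im (pathfinish q)"
  shows "path_image p \<inter> path_image q \<noteq> {}"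
proof -
  have "bounded (path_image p \<union> path_image q)"
    using p q by (simp add: bounded_path_image)
  then obtain B where B: "\<And>z. z \<in> path_image p \<union> path_image q \<Longrightarrow> cmod z \<le> B"
    unfolding bounded_iff by blast
  define a b where "a = Complex (-B) (-B)" and "b = Complex B B"
  have inbox: "path_image p \<union> path_image q \<subseteq> cbox a b"
  proof
    fix z assume "z \<in> path_image p \<union> path_image q"
    then show "z \<in> cbox a b"
      using B[of z] abs_Re_le_cmod[of z] abs_Im_le_cmod[of z]
      by (auto simp: a_def b_def in_cbox_complex_iff)
  qed
  define p1 p2 q1 q2 where "p1 = Complex (-B) (Im (pathstart p))" and "p2 = Complex B (Im (pathfinish p))"
    and "q1 = Complex (Re (pathstart q)) (-B)" and "q2 = Complex (Re (pathfinish q)) B"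
  define P where "P = linepath p1 (pathstart p) +++ p +++ linepath (pathfinish p) p2"
  define Q where "Q = linepath q1 (pathstart q) +++ q +++ linepath (pathfinish q) q2"
  have ends: "pathstart p \<in> cbox a b" "pathfinish p \<in> cbox a b" "pathstart q \<in> cbox a b" "pathfinish q \<in> cbox a b"
    using inbox by auto
  have PI: "path_image P = closed_segment p1 (pathstart p) \<union> path_image p \<union> closed_segment (pathfinish p) p2"
    unfolding P_def by (simp add: path_image_join Un_assoc)
  have QI: "path_image Q = closed_segment q1 (pathstart q) \<union> path_image q \<union> closed_segment (pathfinish q) q2"
    unfolding Q_def by (simp add: path_image_join Un_assoc)
  have "path_image P \<inter> path_image Q \<noteq> {}"
  proof (rule fashoda_complex)
    show "path P" "path Q" unfolding P_def Q_def using p q by auto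
    have "p1 \<in> cbox a b" "p2 \<in> cbox a b" "q1 \<in> cbox a b" "q2 \<in> cbox a b"
      using ends by (auto simp: p1_def p2_def q1_def q2_def a_def b_def in_cbox_complex_iff)
    then have "closed_segment p1 (pathstart p) \<subseteq> cbox a b" "closed_segment (pathfinish p) p2 \<subseteq> cbox a b"
      "closed_segment q1 (pathstart q) \<subseteq> cbox a b" "closed_segment (pathfinish q) q2 \<subseteq> cbox a b"
      using ends by (simp_all add: closed_segment_subset convex_box)
    then show "path_image P \<subseteq> cbox a b" "path_image Q \<subseteq> cbox a b"
      unfolding PI QI using inbox by auto
  qed (auto simp: P_def Q_def p1_def p2_def q1_def q2_def a_def b_def)
  moreover
  \<comment> \<open>Each added segment lies beyond the end to which it is attached and shares one
    coordinate with that end; this rules out all intersections that involve it.\<close>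
  have l: "Re z \<le> Re (pathstart p) \<and> Im z = Im (pathstart p)" if "z \<in> closed_segment p1 (pathstart p)" for z
    using that ends unfolding p1_def a_def b_def
    by (auto simp: closed_segment_same_Im closed_segment_eq_real_ivl in_cbox_complex_iff split: if_splits)
  have r: "Re z \<ge> Re (pathfinish p) \<and> Im z = Im (pathfinish p)" if "z \<in> closed_segment (pathfinish p) p2" for z
    using that ends unfolding p2_def a_def b_def
    by (auto simp: closed_segment_same_Im closed_segment_eq_real_ivl in_cbox_complex_iff split: if_splits)
  have d: "Im z \<le> Im (pathstart q) \<and> Re z = Re (pathstart q)" if "z \<in> closed_segment q1 (pathstart q)" for z
    using that ends unfolding q1_def a_def b_def
    by (auto simp: closed_segment_same_Re closed_segment_eq_real_ivl in_cbox_complex_iff split: if_splits)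
  have u: "Im z \<ge> Im (pathfinish q) \<and> Re z = Re (pathfinish q)" if "z \<in> closed_segment (pathfinish q) q2" for z
    using that ends unfolding q2_def a_def b_def
    by (auto simp: closed_segment_same_Re closed_segment_eq_real_ivl in_cbox_complex_iff split: if_splits)
  ultimately show ?thesis
    unfolding PI QI using Re Im
    by (smt (verit) UnE disjoint_iff l r d u pathfinish_in_path_image pathstart_in_path_image)
qed

text \<open>\<open>Ln\<close> is continuous off the slit, so \<open>p\<close> lifts to
  \<open>Ln \<circ> p\<close> under \<open>exp\<close>, and the winding number is the increment of
  the lift divided by \<open>2 * pi * \<i>\<close>.\<close>

lemma winding_number_slit_plane:
  assumes "path p" "path_image p \<inter> \<real>\<^sub>\<le>\<^sub>0 = {}"
  shows "winding_number p 0 = (Ln (pathfinish p) - Ln (pathstart p)) / (2 * of_real pi * \<i>)"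
proof -
  have "path (Ln \<circ> p)"
    using assms by (intro path_continuous_image continuous_on_Ln) auto
  have "winding_number p 0 = winding_number (exp \<circ> (Ln \<circ> p)) 0"
  proof (rule winding_number_cong)
    fix t :: real assume "0 \<le> t" "t \<le> 1"
    then have "p t \<noteq> 0" using assms(2) by (force simp: path_image_def)
    then show "p t = (exp \<circ> (Ln \<circ> p)) t" by simp
  qed
  then show ?thesis
    using winding_number_compose_exp[OF \<open>path (Ln \<circ> p)\<close>] by (simp add: pathfinish_compose pathstart_compose)
qed

text \<open>Here the lift is \<open>Ln (- p t) + \<i> * pi\<close>, a branch of the logarithm off
  the nonnegative reals. The constant \<open>\<i> * pi\<close> undoes the sign inside
  \<open>Ln\<close> and cancels in the increment.\<close>

lemma winding_number_slit_plane_uminus: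
  assumes "path p" "path_image p \<inter> \<real>\<^sub>\<ge>\<^sub>0 = {}"
  shows "winding_number p 0 = (Ln (- pathfinish p) - Ln (- pathstart p)) / (2 * of_real pi * \<i>)"
proof -
  have "path (\<lambda>t. Ln (- p t) + \<i> * pi)"
    unfolding path_def
  proof (intro continuous_intros)
    show "continuous_on {0..1} p" using assms(1) by (simp add: path_def)
    fix t :: real assume "t \<in> {0..1}"
    then have "p t \<notin> \<real>\<^sub>\<ge>\<^sub>0" using assms(2) unfolding path_image_def by blast
    then show "- p t \<notin> \<real>\<^sub>\<le>\<^sub>0" by (simp add: complex_nonpos_Reals_iff complex_nonneg_Reals_iff)
  qed
  moreover have "winding_number p 0 = winding_number (exp \<circ> (\<lambda>t. Ln (- p t) + \<i> * pi)) 0"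
  proof (rule winding_number_cong)
    fix t :: real assume "0 \<le> t" "t \<le> 1"
    then have "p t \<noteq> 0" using assms(2) by (force simp: path_image_def)
    then show "p t = (exp \<circ> (\<lambda>t. Ln (- p t) + \<i> * pi)) t" by (simp add: exp_add)
  qed
  ultimately show ?thesis
    using winding_number_compose_exp by (simp add: pathfinish_def pathstart_def)
qed

text \<open>On \<open>p\<close>, \<open>q\<close> and \<open>q'\<close> the increments of \<open>Ln\<close> telescope; on \<open>p'\<close> one passes to \<open>Ln (- z)\<close>, and the
  two changes of branch contribute \<open>2 * pi * \<i>\<close>.\<close>

lemma winding_number_four_pieces:
  assumes paths: "path p" "path q" "path p'" "path q'"
    and joins: "pathfinish p = pathstart q" "pathfinish q = pathstart p'" "pathfinish p' = pathstart q'"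
      "pathfinish q' = pathstart p"
    and slit: "path_image p \<inter> \<real>\<^sub>\<le>\<^sub>0 = {}" "path_image p' \<inter> \<real>\<^sub>\<ge>\<^sub>0 = {}"
    and upper: "\<And>z. z \<in> path_image q \<Longrightarrow> Im z > 0" and lower: "\<And>z. z \<in> path_image q' \<Longrightarrow> Im z < 0"
  shows "winding_number (p +++ q +++ p' +++ q') 0 = 1"
proof -
  have slit': "path_image q \<inter> \<real>\<^sub>\<le>\<^sub>0 = {}" "path_image q' \<inter> \<real>\<^sub>\<le>\<^sub>0 = {}"
    using upper lower by (force simp: complex_nonpos_Reals_iff)+
  have 0: "0 \<notin> path_image p" "0 \<notin> path_image q" "0 \<notin> path_image p'" "0 \<notin> path_image q'"
    using slit slit' by auto
  \<comment> \<open>\<open>p'\<close> starts where \<open>q\<close> ends, in the upper half plane,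
    and ends where \<open>q'\<close> starts, in the lower one. Hence \<open>Ln_minus\<close> shifts
    by \<open>\<i> * pi\<close> with opposite signs at its two ends.\<close>
  have up: "Ln (- pathstart p') = Ln (pathstart p') - \<i> * pi"
    using upper[of "pathstart p'"] joins(2) pathfinish_in_path_image[of q] by (subst Ln_minus) auto
  have lo: "Ln (- pathfinish p') = Ln (pathfinish p') + \<i> * pi"
    using lower[of "pathfinish p'"] joins(3) pathstart_in_path_image[of q'] by (subst Ln_minus) auto
  let ?K = "2 * of_real pi * \<i>"
  have "winding_number (p +++ q +++ p' +++ q') 0
      = winding_number p 0 + (winding_number q 0 + (winding_number p' 0 + winding_number q' 0))"
    using paths joins 0 by (simp add: winding_number_join path_image_join)
  also have "\<dots> = (Ln (pathstart q) - Ln (pathstart p)) / ?K + ((Ln (pathstart p') - Ln (pathstart q)) / ?K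
      + ((Ln (- pathfinish p') - Ln (- pathstart p')) / ?K + (Ln (pathstart p) - Ln (pathstart q')) / ?K))"
    using paths joins slit slit' by (simp add: winding_number_slit_plane winding_number_slit_plane_uminus)
  also have "\<dots> = 1"
    unfolding up lo unfolding joins by (simp add: divide_simps)
  finally show ?thesis .
qed

section \<open>The chordal metric\<close>

text \<open>\<open>complex \<times> real\<close> carries the Euclidean metric of three-space. The
  point at infinity goes to the north pole.\<close>

definition stereographic :: "extended_complex \<Rightarrow> complex \<times> real" where
  "stereographic a = (case a of
     None \<Rightarrow> (0, 1)
   | Some z \<Rightarrow> (2 * z / of_real (1 + (cmod z)\<^sup>2), ((cmod z)\<^sup>2 - 1) / (1 + (cmod z)\<^sup>2)))"

lemma one_plus_norm_square_pos: "1 + (cmod z)\<^sup>2 > 0"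
  by (simp add: add_pos_nonneg)

text \<open>The metric laws of \<open>chordal_dist\<close> are inherited through this isometry.
  Comparing squares reduces it to rational identities in the real coordinates.\<close>

lemma chordal_dist_eq_dist_stereographic:
  "chordal_dist a b = dist (stereographic a) (stereographic b)"
proof -
  have SS: "chordal_dist (Some z) (Some w) = dist (stereographic (Some z)) (stereographic (Some w))" for z w
  proof -
    define x y u v where "x = Re z" and "y = Im z" and "u = Re w" and "v = Im w"
    define A B where "A = 1 + (x\<^sup>2 + y\<^sup>2)" and "B = 1 + (u\<^sup>2 + v\<^sup>2)"
    have AB: "A > 0" "B > 0" unfolding A_def B_def by (simp_all add: add_pos_nonneg)
    have nz: "(cmod z)\<^sup>2 = x\<^sup>2 + y\<^sup>2" "(cmod w)\<^sup>2 = u\<^sup>2 + v\<^sup>2" by (simp_all add: cmod_power2 x_def y_def u_def v_def)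
    have "(dist (stereographic (Some z)) (stereographic (Some w)))\<^sup>2
        = (2 * x / A - 2 * u / B)\<^sup>2 + (2 * y / A - 2 * v / B)\<^sup>2 + ((A - 2) / A - (B - 2) / B)\<^sup>2"
      unfolding stereographic_def option.case dist_Pair_Pair real_sqrt_pow2_iff nz A_def[symmetric] B_def[symmetric]
      by (simp add: dist_norm cmod_power2 nz x_def y_def u_def v_def flip: A_def B_def) (simp add: A_def B_def x_def y_def u_def v_def)
    also have "\<dots> = 4 * ((x - u)\<^sup>2 + (y - v)\<^sup>2) / (A * B)"
    proof -
      have *: "(2 * x / A - 2 * u / B)\<^sup>2 + (2 * y / A - 2 * v / B)\<^sup>2 + ((A - 2) / A - (B - 2) / B)\<^sup>2
         = 4 * ((x * B - u * A)\<^sup>2 + (y * B - v * A)\<^sup>2 + (A - B)\<^sup>2) / (A * B)\<^sup>2"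
        using AB by (simp add: divide_simps) algebra
      have "(x * B - u * A)\<^sup>2 + (y * B - v * A)\<^sup>2 + (A - B)\<^sup>2 = ((x - u)\<^sup>2 + (y - v)\<^sup>2) * (A * B)"
        unfolding A_def B_def by algebra
      then show ?thesis unfolding * using AB by (simp add: divide_simps power2_eq_square)
    qed
    also have "\<dots> = (chordal_dist (Some z) (Some w))\<^sup>2"
      using AB by (simp add: power_divide power_mult_distrib nz cmod_power2 x_def y_def u_def v_def A_def B_def)
    finally have "(dist (stereographic (Some z)) (stereographic (Some w)))\<^sup>2 = (chordal_dist (Some z) (Some w))\<^sup>2" .
    then show ?thesis by (simp add: power2_eq_iff_nonneg)
  qed
  have SN: "dist (stereographic (Some z)) (stereographic None) = 2 / sqrt (1 + (cmod z)\<^sup>2)" for z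
  proof -
    define A where "A = 1 + (cmod z)\<^sup>2"
    have A: "A > 0" unfolding A_def by (rule one_plus_norm_square_pos)
    have "(dist (stereographic (Some z)) (stereographic None))\<^sup>2 = (2 * cmod z / A)\<^sup>2 + ((A - 2) / A - 1)\<^sup>2"
    proof -
      have st: "stereographic (Some z) = (2 * z / of_real A, (A - 2) / A)"
        by (simp add: stereographic_def A_def)
      have sn: "stereographic None = (0, 1)" by (simp add: stereographic_def)
      have cm: "cmod (2 * z / of_real A) = 2 * cmod z / A"
        using A by (simp add: norm_divide norm_mult)
      show ?thesis
        unfolding st sn dist_Pair_Pair by (simp add: dist_norm cm del: norm_divide norm_mult)
    qed
    also have "\<dots> = 4 * (cmod z)\<^sup>2 / A\<^sup>2 + 4 / A\<^sup>2"
      using A by (simp add: divide_simps power2_eq_square)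
    also have "\<dots> = 4 / A"
    proof -
      have "(cmod z)\<^sup>2 = A - 1" by (simp add: A_def)
      then show ?thesis using A by (simp add: divide_simps power2_eq_square)
    qed
    also have "\<dots> = (2 / sqrt A)\<^sup>2" using A by (simp add: power_divide)
    finally have "(dist (stereographic (Some z)) (stereographic None))\<^sup>2 = (2 / sqrt A)\<^sup>2" .
    then show ?thesis using A by (simp add: power2_eq_iff_nonneg A_def)
  qed
  show ?thesis
    by (cases a; cases b) (use SS SN in \<open>auto simp: dist_commute\<close>)
qed

lemma chordal_dist_triangle: "chordal_dist a c \<le> chordal_dist a b + chordal_dist b c"
  unfolding chordal_dist_eq_dist_stereographic by (rule dist_triangle)

lemma chordal_dist_commute: "chordal_dist a b = chordal_dist b a"
  unfolding chordal_dist_eq_dist_stereographic by (rule dist_commute)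

lemma chordal_dist_nonneg: "0 \<le> chordal_dist a b"
  unfolding chordal_dist_eq_dist_stereographic by simp

lemma chordal_dist_eq_0D: "chordal_dist a b = 0 \<Longrightarrow> a = b"
proof -
  have "sqrt (1 + (cmod z)\<^sup>2) \<noteq> 0" for z using one_plus_norm_square_pos[of z] by simp
  then show "chordal_dist a b = 0 \<Longrightarrow> a = b" by (cases a; cases b) auto
qed

lemma chordal_ball_infinity:
  obtains \<delta> where "\<delta> > 0" "\<And>z. Some z \<in> chordal_ball None \<delta> \<Longrightarrow> M < cmod z"
proof
  \<comment> \<open>This radius is the chordal distance from infinity to a point of modulus
    \<open>\<bar>M\<bar>\<close>; \<open>M\<close> may be negative.\<close>
  show "2 / sqrt (1 + M\<^sup>2) > 0" by (simp add: add_pos_nonneg)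
  fix z assume "Some z \<in> chordal_ball None (2 / sqrt (1 + M\<^sup>2))"
  then have "2 / sqrt (1 + (cmod z)\<^sup>2) < 2 / sqrt (1 + M\<^sup>2)" by (simp add: chordal_ball_def)
  then have "sqrt (1 + M\<^sup>2) < sqrt (1 + (cmod z)\<^sup>2)"
    using one_plus_norm_square_pos[of z] by (simp add: divide_simps split: if_splits)
  then have "M\<^sup>2 < (cmod z)\<^sup>2" by simp
  then show "M < cmod z" by (rule power_less_imp_less_base) simp
qed

text \<open>With \<open>t = cmod (z - w)\<close>, the bound
  \<open>sqrt (1 + (cmod z)\<^sup>2) \<le> 1 + cmod w + t\<close> gives
  \<open>2 * t < \<delta> * C * (1 + cmod w) + \<delta> * C * t\<close>. The two terms of the
  minimum defining \<open>\<delta>\<close> bound the first summand by \<open>e\<close> and the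
  second by \<open>t\<close>.\<close>

lemma chordal_ball_finite:
  assumes "e > 0"
  obtains \<delta> where "\<delta> > 0" "\<And>z. Some z \<in> chordal_ball (Some w) \<delta> \<Longrightarrow> cmod (z - w) < e"
proof -
  define C where "C = sqrt (1 + (cmod w)\<^sup>2)"
  have C: "C > 0" unfolding C_def using one_plus_norm_square_pos[of w] by simp
  define \<delta> where "\<delta> = min (1 / C) (e / (C * (1 + cmod w)))"
  have w: "1 + cmod w > 0" by (simp add: add_pos_nonneg)
  have \<delta>: "\<delta> > 0" "\<delta> * C \<le> 1" "\<delta> * C * (1 + cmod w) \<le> e"
  proof -
    show "\<delta> > 0" unfolding \<delta>_def using C assms w by simp
    show "\<delta> * C \<le> 1" using C unfolding \<delta>_def by (simp add: min_def field_simps)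
    have "\<delta> \<le> e / (C * (1 + cmod w))" unfolding \<delta>_def by simp
    then show "\<delta> * C * (1 + cmod w) \<le> e" using C w by (simp add: pos_le_divide_eq mult.assoc)
  qed
  show thesis
  proof (rule that[OF \<delta>(1)])
    fix z assume z: "Some z \<in> chordal_ball (Some w) \<delta>"
    define t where "t = cmod (z - w)"
    have "sqrt (1 + (cmod z)\<^sup>2) \<le> 1 + cmod z"
      by (rule real_le_lsqrt) (auto simp: power2_eq_square algebra_simps)
    also have "cmod z \<le> cmod w + t" unfolding t_def using norm_triangle_sub by blast
    finally have le: "sqrt (1 + (cmod z)\<^sup>2) \<le> 1 + cmod w + t" by simp
    have "2 * t / (C * sqrt (1 + (cmod z)\<^sup>2)) < \<delta>"
      using z by (simp add: chordal_ball_def C_def t_def norm_minus_commute)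
    moreover have "sqrt (1 + (cmod z)\<^sup>2) > 0" using one_plus_norm_square_pos by simp
    ultimately have "2 * t < \<delta> * C * sqrt (1 + (cmod z)\<^sup>2)"
      using C by (simp add: pos_divide_less_eq mult.assoc)
    also have "\<dots> \<le> \<delta> * C * (1 + cmod w + t)"
      using le \<delta>(1) C by (intro mult_left_mono) auto
    also have "\<dots> = \<delta> * C * (1 + cmod w) + \<delta> * C * t" by (simp add: algebra_simps)
    also have "\<dots> \<le> e + 1 * t"
      by (intro add_mono \<delta>(3) mult_right_mono \<delta>(2)) (simp add: t_def)
    finally show "cmod (z - w) < e" by (simp add: t_def)
  qed
qed

section \<open>Paths to the circle and arcs tending to it\<close>

text \<open>By compactness some uniform neighbourhood of \<open>T\<close> lies in the open set, and
  one half of the Hausdorff condition applies. The other half is extracted in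
  \<open>sets_tend_to_eventually_meets\<close>.\<close>

lemma sets_tend_to_eventually_subset:
  assumes "sets_tend_to S T" "compact T" "open O'" "T \<subseteq> O'"
  shows "\<forall>\<^sub>F n in sequentially. S n \<subseteq> O'"
proof -
  obtain e where e: "e > 0" "(\<Union>x\<in>T. ball x e) \<subseteq> O'"
    using compact_subset_open_imp_ball_epsilon_subset[OF assms(2-4)] .
  have "\<forall>\<^sub>F n in sequentially. \<forall>z\<in>S n. \<exists>w\<in>T. dist z w < e"
    using assms(1) e(1) unfolding sets_tend_to_def by (force elim: eventually_mono)
  then show ?thesis
  proof (rule eventually_mono)
    fix n assume n: "\<forall>z\<in>S n. \<exists>w\<in>T. dist z w < e"
    then have "S n \<subseteq> (\<Union>x\<in>T. ball x e)" by (auto simp: dist_commute)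
    then show "S n \<subseteq> O'" using e(2) by blast
  qed
qed

lemma sets_tend_to_eventually_meets:
  assumes "sets_tend_to S T" "w \<in> T" "open O'" "w \<in> O'"
  shows "\<forall>\<^sub>F n in sequentially. \<exists>z\<in>S n. z \<in> O'"
proof -
  obtain e where e: "e > 0" "ball w e \<subseteq> O'" using assms openE by meson
  have "\<forall>\<^sub>F n in sequentially. \<forall>w\<in>T. \<exists>z\<in>S n. dist z w < e"
    using assms(1) e(1) unfolding sets_tend_to_def by (force elim: eventually_mono)
  then show ?thesis
    by (rule eventually_mono) (use assms(2) e(2) in \<open>force simp: dist_commute\<close>)
qed

text \<open>Outside a neighbourhood of \<zeta> the closure of the path is a compact subset of the
  open disc, so its moduli stay below some \<open>r < 1\<close>. Once the modulus on the path
  exceeds \<open>r\<close>, the path is in the neighbourhood.\<close>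

lemma boundary_path_tendsto:
  assumes "boundary_path \<Gamma>" "path_end \<Gamma> = {\<zeta>}"
  shows "(\<Gamma> \<longlongrightarrow> \<zeta>) (at_left 1)"
proof (rule topological_tendstoI)
  fix U assume U: "open U" "\<zeta> \<in> U"
  define C where "C = closure (\<Gamma> ` {0..<1}) - U"
  have disc: "\<Gamma> ` {0..<1} \<subseteq> ball 0 1" and lim: "((\<lambda>t. cmod (\<Gamma> t)) \<longlongrightarrow> 1) (at_left 1)"
    using assms(1) by (auto simp: boundary_path_def)
  have cl: "closure (\<Gamma> ` {0..<1}) \<subseteq> cball 0 1"
    using disc by (intro closure_minimal) (auto simp: subset_iff less_imp_le)
  have "bounded (closure (\<Gamma> ` {0..<1}))" using cl bounded_subset bounded_cball by metis
  then have "compact C"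
    unfolding C_def using U(1) by (intro compact_diff) (auto simp: compact_eq_bounded_closed)
  have inC: "cmod z < 1" if "z \<in> C" for z
    using that cl assms(2) U(2) unfolding C_def path_end_def by (force simp: less_le)
  have "\<exists>r<1. \<forall>z\<in>C. cmod z \<le> r"
  proof (cases "C = {}")
    case False
    then show ?thesis
      using continuous_attains_sup[OF \<open>compact C\<close>, of cmod] inC continuous_on_norm_id by metis
  qed (auto intro: exI[of _ 0])
  then obtain r where r: "r < 1" "\<And>z. z \<in> C \<Longrightarrow> cmod z \<le> r" by blast
  have "\<forall>\<^sub>F t in at_left 1. r < cmod (\<Gamma> t)" using lim r(1) by (rule order_tendstoD)
  moreover have "\<forall>\<^sub>F t in at_left 1. t \<in> {0<..<1::real}"
    by (rule eventually_at_leftI[of 0]) auto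
  ultimately show "\<forall>\<^sub>F t in at_left 1. \<Gamma> t \<in> U"
  proof eventually_elim
    case (elim t)
    then have "\<Gamma> t \<in> closure (\<Gamma> ` {0..<1})" using closure_subset by force
    then show ?case using elim r(2) unfolding C_def by force
  qed
qed

lemma eventually_at_left_1_tail:
  assumes "\<forall>\<^sub>F t in at_left 1. P t"
  obtains T where "0 \<le> T" "T < (1::real)" "\<And>t. T \<le> t \<Longrightarrow> t < 1 \<Longrightarrow> P t"
proof -
  obtain b where b: "b < 1" "\<And>t. b < t \<Longrightarrow> t < 1 \<Longrightarrow> P t"
    using assms unfolding eventually_at_left_field by blast
  \<comment> \<open>\<open>b\<close> may be negative and the property has to hold at
    \<open>T\<close> itself, hence a midpoint strictly between \<open>max b 0\<close> and 1.\<close>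
  show thesis
    by (rule that[of "(max b 0 + 1) / 2"]) (use b in \<open>auto simp: field_simps\<close>)
qed

lemma Ln_cis_of_real: "\<bar>t\<bar> < pi \<Longrightarrow> Ln (cis t) = \<i> * t"
  unfolding cis_conv_exp by (rule Ln_exp) auto

text \<open>Together with its negative this arc covers the circle, and each of the two lies in a slit plane,
  where the argument is single-valued.\<close>

definition right_arc :: "real \<Rightarrow> complex" where
  "right_arc = part_circlepath 0 1 (- (3 * pi / 4)) (3 * pi / 4)"

lemma arc_right_arc: "arc right_arc"
  unfolding right_arc_def by (rule arc_part_circlepath) (use pi_gt_zero in auto)

lemma path_image_right_arc: "path_image right_arc = cis ` {- (3 * pi / 4)..3 * pi / 4}"
  unfolding right_arc_def by (subst path_image_part_circlepath) (auto simp: cis_conv_exp)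

lemma compact_path_image_right_arc: "compact (path_image right_arc)"
  using arc_right_arc by (simp add: arc_imp_path compact_path_image)

lemma cis_notin_nonpos_Reals:
  assumes "\<bar>t\<bar> < pi"
  shows "cis t \<notin> \<real>\<^sub>\<le>\<^sub>0"
proof
  assume "cis t \<in> \<real>\<^sub>\<le>\<^sub>0"
  then obtain r where r: "cis t = of_real r" "r \<le> 0" by (auto elim!: nonpos_Reals_cases)
  then have "\<bar>r\<bar> = 1" by (metis norm_cis norm_of_real)
  then have "cis t = - 1" using r by simp
  then have "\<i> * t = \<i> * pi" using Ln_cis_of_real[of t] assms by simp
  then show False using assms by simp
qed

lemma right_arc_subset:
  assumes "\<rho> < 1"
  shows "path_image right_arc \<subseteq> - cball 0 \<rho> - \<real>\<^sub>\<le>\<^sub>0"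
proof -
  have "cis t \<notin> \<real>\<^sub>\<le>\<^sub>0" if "\<bar>t\<bar> \<le> 3 * pi / 4" for t
    using that pi_gt_zero by (intro cis_notin_nonpos_Reals) linarith
  then show ?thesis using assms unfolding path_image_right_arc by auto
qed

text \<open>In the coordinate \<open>Ln\<close> the curve runs from left to right towards the imaginary axis, while
  the arcs contain paths running from below to above it.\<close>

lemma path_to_circle_meets_arcs:
  fixes \<Gamma> :: "real \<Rightarrow> complex"
  assumes cont: "continuous_on {0..<1} \<Gamma>"
    and disc: "\<And>t. \<lbrakk>0 \<le> t; t < 1\<rbrakk> \<Longrightarrow> cmod (\<Gamma> t) < 1"
    and lim: "(\<Gamma> \<longlongrightarrow> \<zeta>) (at_left 1)" and \<zeta>: "cmod \<zeta> = 1" "\<bar>Im (Ln \<zeta>)\<bar> < 3 * pi / 4"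
    and arcs: "\<forall>\<^sub>F n in sequentially. path (g n) \<and> path_image (g n) \<subseteq> ball 0 1"
    and tends: "sets_tend_to (\<lambda>n. path_image (g n)) (path_image right_arc)"
    and T: "0 \<le> T" "T < 1"
  shows "\<forall>\<^sub>F n in sequentially. \<exists>t. T \<le> t \<and> t < 1 \<and> \<Gamma> t \<in> path_image (g n)"
proof -
  \<comment> \<open>\<open>m\<close> leaves a margin on both sides: a tail of the curve stays within
    height \<open>m\<close> in the \<open>Ln\<close> coordinate, while the ends of the arcs pass
    beyond it.\<close>
  obtain m where m: "\<bar>Im (Ln \<zeta>)\<bar> < m" "m < 3 * pi / 4" using \<zeta>(2) dense by blast
  have \<zeta>slit: "\<zeta> \<notin> \<real>\<^sub>\<le>\<^sub>0"
  proof
    assume "\<zeta> \<in> \<real>\<^sub>\<le>\<^sub>0"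
    then have "\<zeta> = - 1" using \<zeta>(1) by (auto elim!: nonpos_Reals_cases)
    then show False using \<zeta>(2) by simp
  qed
  have Re\<zeta>: "Re (Ln \<zeta>) = 0"
    using \<zeta>(1) Re_Ln[of \<zeta>] by (cases "\<zeta> = 0") auto
  have limLn: "((\<lambda>t. Ln (\<Gamma> t)) \<longlongrightarrow> Ln \<zeta>) (at_left 1)"
    using lim \<zeta>slit by (intro tendsto_intros)
  have "\<forall>\<^sub>F t in at_left 1. \<bar>Im (Ln (\<Gamma> t))\<bar> < m"
    by (rule order_tendstoD(2)[OF tendsto_rabs[OF tendsto_Im[OF limLn]] m(1)])
  moreover have "\<forall>\<^sub>F t in at_left 1. \<Gamma> t \<in> - \<real>\<^sub>\<le>\<^sub>0"
    using topological_tendstoD[OF lim, of "- \<real>\<^sub>\<le>\<^sub>0"] \<zeta>slit by (simp add: open_Compl)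
  moreover have "\<forall>\<^sub>F t in at_left 1. T < t"
    by (rule eventually_at_leftI[of T]) (use T in auto)
  ultimately have "\<forall>\<^sub>F t in at_left 1. \<bar>Im (Ln (\<Gamma> t))\<bar> < m \<and> \<Gamma> t \<in> - \<real>\<^sub>\<le>\<^sub>0 \<and> T < t"
    by eventually_elim auto
  then obtain S where S: "0 \<le> S" "S < 1"
    "\<And>t. S \<le> t \<Longrightarrow> t < 1 \<Longrightarrow> \<bar>Im (Ln (\<Gamma> t))\<bar> < m \<and> \<Gamma> t \<in> - \<real>\<^sub>\<le>\<^sub>0 \<and> T < t"
    using eventually_at_left_1_tail by blast
  \<comment> \<open>Adding the limit on the imaginary axis makes the tail of the curve a path on a
    closed interval.\<close>
  define G where "G = (\<lambda>t. if t = 1 then Ln \<zeta> else Ln (\<Gamma> t))"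
  have "continuous_on {S..1} G"
    unfolding continuous_on_def
  proof
    fix x assume x: "x \<in> {S..1}"
    show "(G \<longlongrightarrow> G x) (at x within {S..1})"
    proof (cases "x = 1")
      case True
      have "(G \<longlongrightarrow> Ln \<zeta>) (at_left 1)"
        by (rule Lim_transform_eventually[OF limLn]) (auto simp: G_def eventually_at_filter)
      then show ?thesis using True S(2) by (simp add: at_within_Icc_at_left G_def)
    next
      case False
      have "continuous_on {S..<1} (\<lambda>t. Ln (\<Gamma> t))"
        using S by (intro continuous_on_Ln' continuous_on_subset[OF cont]) auto
      then have "continuous_on {S..<1} G"
        by (rule continuous_on_eq) (auto simp: G_def)
      moreover have "at x within {S..1} = at x within {S..<1}"
        by (rule at_within_nhd[of x "{..<1}"]) (use x False in auto)
      ultimately show ?thesis using x False by (auto simp: continuous_on_def)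
    qed
  qed
  define p where "p = (\<lambda>s. G (S + s * (1 - S)))"
  have rng: "S \<le> S + s * (1 - S) \<and> S + s * (1 - S) \<le> 1" if "s \<in> {0..1}" for s
  proof -
    define d where "d = s * (1 - S)"
    have "d \<le> 1 * (1 - S)" unfolding d_def using that S(2) by (intro mult_right_mono) auto
    moreover have "0 \<le> d" using that S(2) by (simp add: d_def)
    ultimately show ?thesis unfolding d_def[symmetric] by simp
  qed
  have "path p"
    unfolding path_def p_def
    by (rule continuous_on_compose2[OF \<open>continuous_on {S..1} G\<close>]) (use rng in \<open>auto intro!: continuous_intros\<close>)
  have p0: "pathstart p = Ln (\<Gamma> S)" and p1: "pathfinish p = Ln \<zeta>"
    using S(2) by (auto simp: p_def G_def pathstart_def pathfinish_def)
  have pimg: "path_image p \<subseteq> G ` {S..1}"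
    using rng unfolding p_def path_image_def by auto
  have pIm: "- m < Im z \<and> Im z < m" if "z \<in> path_image p" for z
    using that pimg S(3) m by (force simp: G_def abs_less_iff)
  have GS: "0 < cmod (\<Gamma> S)" using S(3)[of S] S(2) by auto
  \<comment> \<open>Outside this disc and off the slit, \<open>Ln\<close> is continuous and maps
    strictly to the right of the starting point of \<open>p\<close>.\<close>
  define O' where "O' = - cball 0 (cmod (\<Gamma> S)) - (\<real>\<^sub>\<le>\<^sub>0 :: complex set)"
  have "\<forall>\<^sub>F n in sequentially. path_image (g n) \<subseteq> O'"
  proof (rule sets_tend_to_eventually_subset[OF tends])
    show "open O'" unfolding O'_def by (intro open_Diff open_Compl) auto
    show "path_image right_arc \<subseteq> O'"
      unfolding O'_def using disc S by (intro right_arc_subset) auto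
  qed (rule compact_path_image_right_arc)
  \<comment> \<open>The ends of \<open>right_arc\<close> have argument \<open>- (3 * pi / 4)\<close>
    and \<open>3 * pi / 4\<close>, so arcs near it have points below height \<open>- m\<close> and
    points above \<open>m\<close>.\<close>
  moreover have "\<forall>\<^sub>F n in sequentially. \<exists>z\<in>path_image (g n). z \<in> - \<real>\<^sub>\<le>\<^sub>0 \<inter> Ln -` {z. Im z < - m}"
  proof (rule sets_tend_to_eventually_meets[OF tends, where w = "cis (- (3 * pi / 4))"])
    show "open (- \<real>\<^sub>\<le>\<^sub>0 \<inter> Ln -` {z. Im z < - m})"
      by (intro continuous_open_preimage continuous_on_Ln open_halfspace_Im_lt) auto
    show "cis (- (3 * pi / 4)) \<in> path_image right_arc" unfolding path_image_right_arc by auto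
    show "cis (- (3 * pi / 4)) \<in> - \<real>\<^sub>\<le>\<^sub>0 \<inter> Ln -` {z. Im z < - m}"
      using arg_cong[OF Ln_cis_of_real[of "- (3 * pi / 4)"], of Im] m cis_notin_nonpos_Reals[of "- (3 * pi / 4)"] pi_gt_zero
      by simp
  qed
  moreover have "\<forall>\<^sub>F n in sequentially. \<exists>z\<in>path_image (g n). z \<in> - \<real>\<^sub>\<le>\<^sub>0 \<inter> Ln -` {z. Im z > m}"
  proof (rule sets_tend_to_eventually_meets[OF tends, where w = "cis (3 * pi / 4)"])
    show "open (- \<real>\<^sub>\<le>\<^sub>0 \<inter> Ln -` {z. Im z > m})"
      by (intro continuous_open_preimage continuous_on_Ln open_halfspace_Im_gt) auto
    show "cis (3 * pi / 4) \<in> path_image right_arc" unfolding path_image_right_arc by auto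
    show "cis (3 * pi / 4) \<in> - \<real>\<^sub>\<le>\<^sub>0 \<inter> Ln -` {z. Im z > m}"
      using arg_cong[OF Ln_cis_of_real[of "3 * pi / 4"], of Im] m cis_notin_nonpos_Reals[of "3 * pi / 4"] pi_gt_zero
      by simp
  qed
  ultimately show ?thesis using arcs
  proof eventually_elim
    case (elim n)
    then obtain u1 u2 where u: "u1 \<in> path_image (g n)" "Im (Ln u1) < - m" "u2 \<in> path_image (g n)" "m < Im (Ln u2)"
      by auto
    have "path_connected (path_image (g n))" using elim by (simp add: path_connected_path_image)
    then obtain h where h: "path h" "path_image h \<subseteq> path_image (g n)" "pathstart h = u1" "pathfinish h = u2"
      using u unfolding path_connected_def by blast
    have hO: "path_image h \<subseteq> O'" using h elim by blast
    have nn: "\<And>z. z \<in> path_image h \<Longrightarrow> cmod (\<Gamma> S) < cmod z \<and> z \<noteq> 0 \<and> cmod z < 1"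
      using hO h(2) elim GS unfolding O'_def by (fastforce simp: subset_iff)
    have "path_image p \<inter> path_image (Ln \<circ> h) \<noteq> {}"
    proof (rule crossing_paths_meet[OF \<open>path p\<close>])
      show "path (Ln \<circ> h)"
        using h(1) hO unfolding O'_def by (intro path_continuous_image continuous_on_Ln) auto
      show "Re (pathstart p) < Re z \<and> Re z < Re (pathfinish p)" if z: "z \<in> path_image (Ln \<circ> h)" for z
      proof -
        obtain w where w: "w \<in> path_image h" "z = Ln w" using z by (auto simp: path_image_compose)
        have "ln (cmod (\<Gamma> S)) < ln (cmod w)" "ln (cmod w) < 0"
          using nn[OF w(1)] GS by auto
        then show ?thesis using w nn[OF w(1)] GS Re\<zeta> unfolding p0 p1 by auto
      qed
      show "Im (pathstart (Ln \<circ> h)) < Im z \<and> Im z < Im (pathfinish (Ln \<circ> h))" if "z \<in> path_image p" for z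
        using pIm[OF that] u h by (simp add: pathstart_compose pathfinish_compose)
    qed
    then obtain w where w: "w \<in> path_image h" "Ln w \<in> path_image p" by (auto simp: path_image_compose)
    then have "Ln w \<in> G ` {S..1}" using pimg by blast
    then obtain t where t: "S \<le> t" "t \<le> 1" "Ln w = G t" by auto
    \<comment> \<open>The crossing is not at the added endpoint, which lies on the imaginary axis;
      so it comes from a genuine point of the curve.\<close>
    have "Re (Ln w) < 0" using nn[OF w(1)] by (simp add: Re_Ln)
    then have "t \<noteq> 1" using t(3) Re\<zeta> by (auto simp: G_def)
    then have "exp (Ln w) = exp (Ln (\<Gamma> t))" using t(3) by (simp add: G_def)
    moreover have "\<Gamma> t \<noteq> 0" using S(3)[of t] t \<open>t \<noteq> 1\<close> by auto
    ultimately have "w = \<Gamma> t" using nn[OF w(1)] by simp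
    moreover have "t < 1" using t \<open>t \<noteq> 1\<close> by simp
    ultimately show ?case
      using w(1) h(2) S(3)[of t] t(1) by (intro exI[of _ t]) (auto intro: less_imp_le)
  qed
qed

section \<open>The loops provided by a global tract\<close>

lemma sets_tend_to_uminus:
  "sets_tend_to S T \<Longrightarrow> sets_tend_to (\<lambda>n. uminus ` S n) (uminus ` T)"
  unfolding sets_tend_to_def by (simp add: dist_minus)

lemma tract_arcs_eventually:
  assumes "is_tract f D a" "\<And>n. n \<ge> 1 \<Longrightarrow> arc (g n) \<and> path_image (g n) \<subseteq> D (1 / real n)" "\<epsilon> > 0"
  shows "\<forall>\<^sub>F n in sequentially.
    path (g n) \<and> path_image (g n) \<subseteq> {z \<in> ball 0 1. Some (f z) \<in> chordal_ball a \<epsilon>}"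
proof -
  have "\<forall>\<^sub>F n in sequentially. 1 / real n < \<epsilon>"
    using \<open>\<epsilon> > 0\<close> by real_asymp
  then show ?thesis using eventually_ge_at_top[of 1]
  proof eventually_elim
    case (elim n)
    then have "D (1 / real n) \<in> components {z \<in> ball 0 1. Some (f z) \<in> chordal_ball a (1 / real n)}"
      using assms(1) unfolding is_tract_def by simp
    then have "D (1 / real n) \<subseteq> {z \<in> ball 0 1. Some (f z) \<in> chordal_ball a (1 / real n)}"
      by (rule in_components_subset)
    also have "\<dots> \<subseteq> {z \<in> ball 0 1. Some (f z) \<in> chordal_ball a \<epsilon>}"
      using elim by (auto simp: chordal_ball_def)
    finally show ?case using assms(2)[of n] elim arc_imp_path by blast
  qed
qed

text \<open>\<open>K\<close> is a tail of an asymptotic path that ends near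
  \<open>\<zeta>\<^sub>0\<close>. Since \<open>\<zeta>\<^sub>0\<close> is interior to both the right
  and the left part of the circle, every tail meets both families of arcs, and this forces the
  asymptotic value to be \<open>a\<close>.\<close>

lemma connected_set_joining_tract_arcs:
  assumes f: "f \<in> MacLane_class"
    and gR: "\<And>\<epsilon>. \<epsilon> > 0 \<Longrightarrow> \<forall>\<^sub>F n in sequentially.
      path (gR n) \<and> path_image (gR n) \<subseteq> {z \<in> ball 0 1. Some (f z) \<in> chordal_ball a \<epsilon>}"
    and gL: "\<And>\<epsilon>. \<epsilon> > 0 \<Longrightarrow> \<forall>\<^sub>F n in sequentially.
      path (gL n) \<and> path_image (gL n) \<subseteq> {z \<in> ball 0 1. Some (f z) \<in> chordal_ball a \<epsilon>}"
    and tR: "sets_tend_to (\<lambda>n. path_image (gR n)) (path_image right_arc)"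
    and tL: "sets_tend_to (\<lambda>n. path_image (gL n)) (uminus ` path_image right_arc)"
    and \<zeta>0: "cmod \<zeta>\<^sub>0 = 1" "\<zeta>\<^sub>0 \<notin> \<real>" "\<bar>Im (Ln \<zeta>\<^sub>0)\<bar> < 3 * pi / 4" "\<bar>Im (Ln (- \<zeta>\<^sub>0))\<bar> < 3 * pi / 4"
    and O': "open O'" "\<zeta>\<^sub>0 \<in> O'" and "\<rho> < 1" "\<delta> > 0"
  obtains K where "path_connected K"
    "K \<subseteq> {z \<in> ball 0 1. Some (f z) \<in> chordal_ball a \<delta>} \<inter> (O' - cball 0 \<rho>)"
    "\<forall>\<^sub>F n in sequentially. K \<inter> path_image (gR n) \<noteq> {} \<and> K \<inter> path_image (gL n) \<noteq> {}"
proof -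
  have \<zeta>0slit: "\<zeta>\<^sub>0 \<notin> \<real>\<^sub>\<le>\<^sub>0" "- \<zeta>\<^sub>0 \<notin> \<real>\<^sub>\<le>\<^sub>0"
    using \<zeta>0(2) nonpos_Reals_subset_Reals Reals_minus_iff by blast+
  have lims: "((\<lambda>z. \<bar>Im (Ln z)\<bar>) \<longlongrightarrow> \<bar>Im (Ln \<zeta>\<^sub>0)\<bar>) (nhds \<zeta>\<^sub>0)"
    "((\<lambda>z. \<bar>Im (Ln (- z))\<bar>) \<longlongrightarrow> \<bar>Im (Ln (- \<zeta>\<^sub>0))\<bar>) (nhds \<zeta>\<^sub>0)"
    by (intro tendsto_intros filterlim_ident \<zeta>0slit)+
  have "\<forall>\<^sub>F z in nhds \<zeta>\<^sub>0. \<bar>Im (Ln z)\<bar> < 3 * pi / 4" "\<forall>\<^sub>F z in nhds \<zeta>\<^sub>0. \<bar>Im (Ln (- z))\<bar> < 3 * pi / 4"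
    using order_tendstoD(2)[OF lims(1) \<zeta>0(3)] order_tendstoD(2)[OF lims(2) \<zeta>0(4)] by simp_all
  moreover have "\<forall>\<^sub>F z in nhds \<zeta>\<^sub>0. z \<in> O'" using O' by (rule eventually_nhds_in_open)
  ultimately have "\<forall>\<^sub>F z in nhds \<zeta>\<^sub>0. \<bar>Im (Ln z)\<bar> < 3 * pi / 4 \<and> \<bar>Im (Ln (- z))\<bar> < 3 * pi / 4 \<and> z \<in> O'"
    by eventually_elim auto
  then obtain N where N: "open N" "\<zeta>\<^sub>0 \<in> N"
    "\<And>z. z \<in> N \<Longrightarrow> \<bar>Im (Ln z)\<bar> < 3 * pi / 4 \<and> \<bar>Im (Ln (- z))\<bar> < 3 * pi / 4 \<and> z \<in> O'"
    unfolding eventually_nhds by blast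
  have "\<zeta>\<^sub>0 \<in> closure {\<zeta> \<in> unit_circle. \<exists>a. has_asymptotic_value f \<zeta> a}"
    using f \<zeta>0(1) unfolding MacLane_class_def by auto
  then have "{\<zeta> \<in> unit_circle. \<exists>a. has_asymptotic_value f \<zeta> a} \<inter> N \<noteq> {}"
    using N(1,2) closure_iff_nhds_not_empty by blast
  then obtain \<zeta> a' where \<zeta>: "\<zeta> \<in> N" "cmod \<zeta> = 1" "has_asymptotic_value f \<zeta> a'" by auto
  then obtain \<Gamma> where \<Gamma>: "boundary_path \<Gamma>" "path_end \<Gamma> = {\<zeta>}"
    "((\<lambda>t. chordal_dist (Some (f (\<Gamma> t))) a') \<longlongrightarrow> 0) (at_left 1)"
    unfolding has_asymptotic_value_def by blast
  have lim: "(\<Gamma> \<longlongrightarrow> \<zeta>) (at_left 1)" by (rule boundary_path_tendsto[OF \<Gamma>(1,2)])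
  have cont: "continuous_on {0..<1} \<Gamma>" and disc: "\<And>t. \<lbrakk>0 \<le> t; t < 1\<rbrakk> \<Longrightarrow> cmod (\<Gamma> t) < 1"
    using \<Gamma>(1) unfolding boundary_path_def by (auto simp: image_subset_iff)
  have meetR: "\<forall>\<^sub>F n in sequentially. \<exists>t. T \<le> t \<and> t < 1 \<and> \<Gamma> t \<in> path_image (gR n)"
    if "0 \<le> T" "T < 1" for T
  proof (rule path_to_circle_meets_arcs[OF cont disc lim \<zeta>(2) _ _ tR that])
    show "\<bar>Im (Ln \<zeta>)\<bar> < 3 * pi / 4" using N(3) \<zeta>(1) by blast
    show "\<forall>\<^sub>F n in sequentially. path (gR n) \<and> path_image (gR n) \<subseteq> ball 0 1"
      using gR[OF zero_less_one] by (rule eventually_mono) auto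
  qed
  \<comment> \<open>Negation turns the left arcs into arcs tending to \<open>right_arc\<close>, so
    the same crossing lemma applies to \<open>- \<Gamma> t\<close>.\<close>
  have meetL: "\<forall>\<^sub>F n in sequentially. \<exists>t. T \<le> t \<and> t < 1 \<and> \<Gamma> t \<in> path_image (gL n)"
    if "0 \<le> T" "T < 1" for T
  proof -
    have "\<forall>\<^sub>F n in sequentially. \<exists>t. T \<le> t \<and> t < 1 \<and> - \<Gamma> t \<in> path_image (uminus \<circ> gL n)"
    proof (rule path_to_circle_meets_arcs[OF _ _ tendsto_minus[OF lim] _ _ _ _ that])
      show "continuous_on {0..<1} (\<lambda>t. - \<Gamma> t)" by (intro continuous_intros cont)
      show "cmod (- \<Gamma> t) < 1" if "0 \<le> t" "t < 1" for t using disc that by simp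
      show "cmod (- \<zeta>) = 1" using \<zeta>(2) by simp
      show "\<bar>Im (Ln (- \<zeta>))\<bar> < 3 * pi / 4" using N(3) \<zeta>(1) by blast
      show "\<forall>\<^sub>F n in sequentially. path (uminus \<circ> gL n) \<and> path_image (uminus \<circ> gL n) \<subseteq> ball 0 1"
        using gL[OF zero_less_one]
        by (rule eventually_mono) (auto simp: path_image_compose intro!: path_continuous_image continuous_intros)
      show "sets_tend_to (\<lambda>n. path_image (uminus \<circ> gL n)) (path_image right_arc)"
        using sets_tend_to_uminus[OF tL] by (simp add: path_image_compose image_image)
    qed
    then show ?thesis
      by (rule eventually_mono) (auto simp: path_image_compose)
  qed
  \<comment> \<open>At a point where a late tail meets an arc, \<open>f\<close> is close to
    \<open>a'\<close> along the path and close to \<open>a\<close> on the arc.\<close>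
  have "a = a'"
  proof -
    have "chordal_dist a a' \<le> 0 + e" if "e > 0" for e
    proof -
      have "\<forall>\<^sub>F t in at_left 1. chordal_dist (Some (f (\<Gamma> t))) a' < e / 2"
        using \<Gamma>(3) that by (intro order_tendstoD(2)) auto
      then obtain T where T: "0 \<le> T" "T < 1"
        "\<And>t. T \<le> t \<Longrightarrow> t < 1 \<Longrightarrow> chordal_dist (Some (f (\<Gamma> t))) a' < e / 2"
        using eventually_at_left_1_tail by blast
      have "\<forall>\<^sub>F n in sequentially. (\<exists>t. T \<le> t \<and> t < 1 \<and> \<Gamma> t \<in> path_image (gR n))
          \<and> path_image (gR n) \<subseteq> {z \<in> ball 0 1. Some (f z) \<in> chordal_ball a (e / 2)}"
        using meetR[OF T(1,2)] gR[of "e / 2"] that by (auto elim: eventually_elim2)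
      then obtain n t where t: "T \<le> t" "t < 1" "Some (f (\<Gamma> t)) \<in> chordal_ball a (e / 2)"
        using eventually_happens'[OF sequentially_bot] by blast
      then have "chordal_dist a (Some (f (\<Gamma> t))) < e / 2" by (simp add: chordal_ball_def)
      then show ?thesis
        using T(3)[OF t(1,2)] chordal_dist_triangle[of a a' "Some (f (\<Gamma> t))"] by simp
    qed
    then have "chordal_dist a a' \<le> 0" by (rule field_le_epsilon)
    then show ?thesis using chordal_dist_nonneg[of a a'] chordal_dist_eq_0D by simp
  qed
  have "\<forall>\<^sub>F t in at_left 1. chordal_dist (Some (f (\<Gamma> t))) a' < \<delta>"
    using \<Gamma>(3) \<open>\<delta> > 0\<close> by (rule order_tendstoD(2))
  moreover have "\<forall>\<^sub>F t in at_left 1. \<rho> < cmod (\<Gamma> t)"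
    using \<Gamma>(1) \<open>\<rho> < 1\<close> unfolding boundary_path_def by (intro order_tendstoD(1)) auto
  moreover have "\<forall>\<^sub>F t in at_left 1. \<Gamma> t \<in> O'"
    using topological_tendstoD[OF lim O'(1)] N(3)[OF \<zeta>(1)] by simp
  ultimately have "\<forall>\<^sub>F t in at_left 1. chordal_dist (Some (f (\<Gamma> t))) a' < \<delta> \<and> \<rho> < cmod (\<Gamma> t) \<and> \<Gamma> t \<in> O'"
    by eventually_elim auto
  then obtain T where T: "0 \<le> T" "T < 1"
    "\<And>t. T \<le> t \<Longrightarrow> t < 1 \<Longrightarrow> chordal_dist (Some (f (\<Gamma> t))) a' < \<delta> \<and> \<rho> < cmod (\<Gamma> t) \<and> \<Gamma> t \<in> O'"
    using eventually_at_left_1_tail by blast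
  show thesis
  proof (rule that[of "\<Gamma> ` {T..<1}"])
    show "path_connected (\<Gamma> ` {T..<1})"
      by (intro path_connected_continuous_image convex_imp_path_connected continuous_on_subset[OF cont])
        (use T in auto)
    show "\<Gamma> ` {T..<1} \<subseteq> {z \<in> ball 0 1. Some (f z) \<in> chordal_ball a \<delta>} \<inter> (O' - cball 0 \<rho>)"
    proof (intro image_subsetI)
      fix t assume t: "t \<in> {T..<1}"
      then show "\<Gamma> t \<in> {z \<in> ball 0 1. Some (f z) \<in> chordal_ball a \<delta>} \<inter> (O' - cball 0 \<rho>)"
        using T(1) T(3)[of t] disc[of t] \<open>a = a'\<close>
        by (simp add: chordal_ball_def chordal_dist_commute)
    qed
    show "\<forall>\<^sub>F n in sequentially. \<Gamma> ` {T..<1} \<inter> path_image (gR n) \<noteq> {} \<and> \<Gamma> ` {T..<1} \<inter> path_image (gL n) \<noteq> {}"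
      using meetR[OF T(1,2)] meetL[OF T(1,2)] by eventually_elim force
  qed
qed

text \<open>Counterclockwise: along a right arc from \<open>K1\<close> to \<open>K2\<close>, through
  \<open>K2\<close> in the upper half plane, along a left arc back to \<open>K1\<close>, and through
  \<open>K1\<close> in the lower half plane. These positions are what
  \<open>winding_number_four_pieces\<close> asks for.\<close>

lemma global_tract_loop:
  assumes f: "f \<in> MacLane_class" and D: "is_global_tract f D a" and \<rho>: "\<rho> < 1" and \<delta>: "\<delta> > 0"
  obtains c where "path c" "pathfinish c = pathstart c" "path_image c \<subseteq> ball 0 1 - cball 0 \<rho>"
    "winding_number c 0 = 1" "\<And>z. z \<in> path_image c \<Longrightarrow> Some (f z) \<in> chordal_ball a \<delta>"
proof -
  define V where "V = {z \<in> ball 0 1. Some (f z) \<in> chordal_ball a \<delta>}"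
  have tract: "is_tract f D a" using D by (simp add: is_global_tract_def)
  have circ: "path_image right_arc \<subseteq> unit_circle" "path_image (uminus \<circ> right_arc) \<subseteq> unit_circle"
    by (auto simp: path_image_compose path_image_right_arc)
  have arcs: "\<exists>g. (\<forall>n\<ge>1. arc (g n) \<and> path_image (g n) \<subseteq> D (1 / real n)) \<and>
      sets_tend_to (\<lambda>n. path_image (g n)) (path_image \<gamma>)"
    if "arc \<gamma>" "path_image \<gamma> \<subseteq> unit_circle" for \<gamma>
    using D that unfolding is_global_tract_def by blast
  obtain gR where gR: "\<And>n. n \<ge> 1 \<Longrightarrow> arc (gR n) \<and> path_image (gR n) \<subseteq> D (1 / real n)"
    and tR: "sets_tend_to (\<lambda>n. path_image (gR n)) (path_image right_arc)"
    using arcs[OF arc_right_arc circ(1)] by blast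
  have "arc (uminus \<circ> right_arc)"
    using arc_right_arc arc_linear_image_eq[of uminus right_arc] by (simp add: linear_uminus inj_on_def)
  then obtain gL where gL: "\<And>n. n \<ge> 1 \<Longrightarrow> arc (gL n) \<and> path_image (gL n) \<subseteq> D (1 / real n)"
    and tL: "sets_tend_to (\<lambda>n. path_image (gL n)) (uminus ` path_image right_arc)"
    using arcs[OF _ circ(2)] unfolding path_image_compose by blast
  have evR: "\<forall>\<^sub>F n in sequentially.
      path (gR n) \<and> path_image (gR n) \<subseteq> {z \<in> ball 0 1. Some (f z) \<in> chordal_ball a \<epsilon>}" if "\<epsilon> > 0" for \<epsilon>
    by (rule tract_arcs_eventually[OF tract _ that]) (rule gR)
  have evL: "\<forall>\<^sub>F n in sequentially.
      path (gL n) \<and> path_image (gL n) \<subseteq> {z \<in> ball 0 1. Some (f z) \<in> chordal_ball a \<epsilon>}" if "\<epsilon> > 0" for \<epsilon>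
    by (rule tract_arcs_eventually[OF tract _ that]) (rule gL)
  obtain K2 where K2: "path_connected K2" "K2 \<subseteq> V \<inter> ({z. Im z > 0} - cball 0 \<rho>)"
    "\<forall>\<^sub>F n in sequentially. K2 \<inter> path_image (gR n) \<noteq> {} \<and> K2 \<inter> path_image (gL n) \<noteq> {}"
    unfolding V_def
    by (rule connected_set_joining_tract_arcs[OF f evR evL tR tL, of "\<i>" "{z. Im z > 0}" \<rho> \<delta>])
      (use \<rho> \<delta> pi_gt_zero in \<open>auto simp: open_halfspace_Im_gt complex_is_Real_iff\<close>)
  obtain K1 where K1: "path_connected K1" "K1 \<subseteq> V \<inter> ({z. Im z < 0} - cball 0 \<rho>)"
    "\<forall>\<^sub>F n in sequentially. K1 \<inter> path_image (gR n) \<noteq> {} \<and> K1 \<inter> path_image (gL n) \<noteq> {}"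
    unfolding V_def
    by (rule connected_set_joining_tract_arcs[OF f evR evL tR tL, of "- \<i>" "{z. Im z < 0}" \<rho> \<delta>])
      (use \<rho> \<delta> pi_gt_zero in \<open>auto simp: open_halfspace_Im_lt complex_is_Real_iff\<close>)
  have "\<forall>\<^sub>F n in sequentially. path_image (gR n) \<subseteq> - cball 0 \<rho> - \<real>\<^sub>\<le>\<^sub>0"
    by (rule sets_tend_to_eventually_subset[OF tR compact_path_image_right_arc _ right_arc_subset[OF \<rho>]])
      (intro open_Diff open_Compl; simp)
  moreover have "\<forall>\<^sub>F n in sequentially. path_image (gL n) \<subseteq> - cball 0 \<rho> - \<real>\<^sub>\<ge>\<^sub>0"
  proof (rule sets_tend_to_eventually_subset[OF tL])
    show "compact (uminus ` path_image right_arc)"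
      by (intro compact_negations compact_path_image_right_arc)
    show "open (- cball 0 \<rho> - \<real>\<^sub>\<ge>\<^sub>0 :: complex set)" by (intro open_Diff open_Compl; simp)
    show "uminus ` path_image right_arc \<subseteq> - cball 0 \<rho> - \<real>\<^sub>\<ge>\<^sub>0"
      using right_arc_subset[OF \<rho>] by (auto simp: complex_nonneg_Reals_iff complex_nonpos_Reals_iff subset_iff)
  qed
  \<comment> \<open>\<open>K1\<close> and \<open>K2\<close> were fixed independently of
    \<open>n\<close>, so one large index serves for both of them and for both families of
    arcs.\<close>
  ultimately have "\<forall>\<^sub>F n in sequentially. path_image (gR n) \<subseteq> V - cball 0 \<rho> - \<real>\<^sub>\<le>\<^sub>0 \<and> path (gR n)
      \<and> path_image (gL n) \<subseteq> V - cball 0 \<rho> - \<real>\<^sub>\<ge>\<^sub>0 \<and> path (gL n)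
      \<and> K1 \<inter> path_image (gR n) \<noteq> {} \<and> K1 \<inter> path_image (gL n) \<noteq> {}
      \<and> K2 \<inter> path_image (gR n) \<noteq> {} \<and> K2 \<inter> path_image (gL n) \<noteq> {}"
    using K1(3) K2(3) evR[OF \<delta>] evL[OF \<delta>] unfolding V_def by eventually_elim auto
  then obtain n where n: "path_image (gR n) \<subseteq> V - cball 0 \<rho> - \<real>\<^sub>\<le>\<^sub>0" "path (gR n)"
      "path_image (gL n) \<subseteq> V - cball 0 \<rho> - \<real>\<^sub>\<ge>\<^sub>0" "path (gL n)"
      "K1 \<inter> path_image (gR n) \<noteq> {}" "K1 \<inter> path_image (gL n) \<noteq> {}"
      "K2 \<inter> path_image (gR n) \<noteq> {}" "K2 \<inter> path_image (gL n) \<noteq> {}"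
    using eventually_happens'[OF sequentially_bot] by blast
  obtain z1 z1' z2 z2' where z: "z1 \<in> K1 \<inter> path_image (gR n)" "z1' \<in> K1 \<inter> path_image (gL n)"
      "z2 \<in> K2 \<inter> path_image (gR n)" "z2' \<in> K2 \<inter> path_image (gL n)"
    using n(5-8) by blast
  have pc: "\<exists>g. path g \<and> path_image g \<subseteq> S \<and> pathstart g = x \<and> pathfinish g = y"
    if "path_connected S" "x \<in> S" "y \<in> S" for S :: "complex set" and x y
    using that unfolding path_connected_def by blast
  obtain p where p: "path p" "path_image p \<subseteq> path_image (gR n)" "pathstart p = z1" "pathfinish p = z2"
    using pc[OF path_connected_path_image[OF n(2)]] z by blast
  obtain q where q: "path q" "path_image q \<subseteq> K2" "pathstart q = z2" "pathfinish q = z2'"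
    using pc[OF K2(1)] z by blast
  obtain p' where p': "path p'" "path_image p' \<subseteq> path_image (gL n)" "pathstart p' = z2'" "pathfinish p' = z1'"
    using pc[OF path_connected_path_image[OF n(4)]] z by blast
  obtain q' where q': "path q'" "path_image q' \<subseteq> K1" "pathstart q' = z1'" "pathfinish q' = z1"
    using pc[OF K1(1)] z by blast
  have img: "path_image (p +++ q +++ p' +++ q') = path_image p \<union> path_image q \<union> path_image p' \<union> path_image q'"
    using p q p' q' by (simp add: path_image_join Un_assoc)
  have sub: "path_image (p +++ q +++ p' +++ q') \<subseteq> V - cball 0 \<rho>"
    unfolding img using p(2) q(2) p'(2) q'(2) n(1,3) K1(2) K2(2) by blast
  show thesis
  proof (rule that[of "p +++ q +++ p' +++ q'"])
    show "winding_number (p +++ q +++ p' +++ q') 0 = 1"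
      by (rule winding_number_four_pieces) (use p q p' q' n(1,3) K1(2) K2(2) in auto)
  qed (use p q p' q' sub in \<open>auto simp: V_def\<close>)
qed

text \<open>The point \<open>z\<close> links \<open>U\<close> to the disc of radius \<rho>, and
  their union misses the loop, so the winding number is 1 on all of \<open>U\<close>. It is 0
  outside any closed disc that contains the loop, and compactness gives such a disc of radius below
  1.\<close>

lemma connected_set_inside_loop:
  assumes c: "path c" "pathfinish c = pathstart c" "path_image c \<subseteq> ball 0 1 - cball 0 \<rho>"
    "winding_number c 0 = 1" and U: "connected U" "U \<inter> path_image c = {}"
    and z: "z \<in> U" "cmod z \<le> \<rho>"
  shows "\<exists>r<1. U \<subseteq> cball 0 r"
proof -
  obtain r where r: "r < 1" "path_image c \<subseteq> cball 0 r"
  proof -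
    obtain w where "w \<in> path_image c" "\<And>u. u \<in> path_image c \<Longrightarrow> cmod u \<le> cmod w"
      using continuous_attains_sup[of "path_image c" cmod] c(1) continuous_on_norm_id
      by (metis compact_path_image path_image_nonempty)
    then show thesis using c(3) by (intro that[of "cmod w"]) auto
  qed
  have "connected (cball 0 \<rho> \<union> U)"
    using z U(1) by (intro connected_Un) auto
  moreover have "(cball 0 \<rho> \<union> U) \<inter> path_image c = {}" using c(3) U(2) by blast
  moreover have "0 \<in> cball (0 :: complex) \<rho>" using order_trans[OF norm_ge_zero z(2)] by simp
  ultimately have one: "winding_number c u = 1" if "u \<in> U" for u
    using winding_number_eq[OF c(1,2), of u "cball 0 \<rho> \<union> U" 0] that c(4) by simp
  have "u \<in> cball 0 r" if "u \<in> U" for u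
    using one[OF that] winding_number_zero_outside[OF c(1) convex_cball c(2) _ r(2)] by force
  then show ?thesis using r(1) by blast
qed

section \<open>Sublevel sets above the critical values\<close>

text \<open>Near a noncritical point \<open>f\<close> has a holomorphic inverse \<open>g\<close>, so
  the sublevel set is locally the \<open>g\<close>-image of an intersection of two discs, which is
  convex.\<close>

lemma sublevel_set_locally_connected_at:
  assumes holf: "f holomorphic_on S" and S: "open S" "p \<in> S"
    and ndz: "deriv f p \<noteq> 0" and s: "0 < s" "cmod (f p) \<le> s"
  obtains N where "open N" "p \<in> N" "N \<subseteq> S" "connected (N \<inter> {z. cmod (f z) < s})"
    "p \<in> closure {z \<in> S. cmod (f z) < s}"
proof -
  obtain r where r: "r > 0" "ball p r \<subseteq> S" "open (f ` ball p r)" "inj_on f (ball p r)"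
    using has_complex_derivative_locally_invertible[OF holf S(2,1) ndz] .
  have holr: "f holomorphic_on ball p r" using holf r by (blast intro: holomorphic_on_subset)
  obtain g where g: "g holomorphic_on f ` ball p r" "\<And>z. z \<in> ball p r \<Longrightarrow> g (f z) = z"
    using holomorphic_has_inverse[OF holr _ r(4)] by (metis open_ball)
  obtain \<delta> where \<delta>: "\<delta> > 0" "ball (f p) \<delta> \<subseteq> f ` ball p r"
    using r by (metis centre_in_ball image_eqI openE)
  define N where "N = ball p r \<inter> f -` ball (f p) \<delta>"
  have "N \<inter> {z. cmod (f z) < s} = g ` (ball (f p) \<delta> \<inter> ball 0 s)"
    using \<delta> g(2) unfolding N_def by (fastforce simp: image_iff)
  moreover have "connected (g ` (ball (f p) \<delta> \<inter> ball 0 s))"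
    by (intro connected_continuous_image convex_connected convex_Int convex_ball
        holomorphic_on_imp_continuous_on holomorphic_on_subset[OF g(1)]) (use \<delta> in blast)
  moreover have "open N"
    unfolding N_def by (intro continuous_open_preimage holomorphic_on_imp_continuous_on holr) auto
  \<comment> \<open>\<open>f\<close> is open near \<open>p\<close>, and \<open>f p\<close> lies in
    the closure of the disc of radius \<open>s\<close>; so values of modulus below \<open>s\<close>
    are taken arbitrarily close to \<open>p\<close>.\<close>
  moreover have "p \<in> closure {z \<in> S. cmod (f z) < s}"
    unfolding closure_iff_nhds_not_empty
  proof (intro allI impI)
    fix A U assume A: "U \<subseteq> A" "open U" "p \<in> U"
    have "open (f ` (U \<inter> ball p r))"
      by (rule open_mapping_thm3) (use A r holr in \<open>auto intro: holomorphic_on_subset inj_on_subset\<close>)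
    moreover have "f p \<in> f ` (U \<inter> ball p r)" using A r by auto
    ultimately obtain e where e: "e > 0" "ball (f p) e \<subseteq> f ` (U \<inter> ball p r)"
      by (meson openE)
    have "f p \<in> closure (ball 0 s)" using s by simp
    then have "ball 0 s \<inter> ball (f p) e \<noteq> {}"
      using e(1) open_Int_closure_eq_empty[of "ball (f p) e" "ball 0 s"] by (metis centre_in_ball disjoint_iff inf_commute open_ball)
    then obtain v where v: "cmod v < s" "v \<in> ball (f p) e" by auto
    then obtain z where "z \<in> U" "z \<in> ball p r" "cmod (f z) < s" using e by blast
    then show "{z \<in> S. cmod (f z) < s} \<inter> A \<noteq> {}" using A r by blast
  qed
  ultimately show thesis
    using that[of N] r \<delta> unfolding N_def by auto
qed

text \<open>Two points of the sublevel set for \<open>M\<close> are joined at some higher level. Let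
  \<open>s0\<close> be the infimum of the levels from \<open>M\<close> on at which they are joined:
  they are still joined at \<open>s0\<close>, because no critical point has level at least
  \<open>M\<close>, and then also slightly below, so \<open>s0 = M\<close>.\<close>

lemma connected_sublevel_set_above_critical_values:
  assumes holf: "f holomorphic_on ball 0 1"
    and rel: "\<And>M U. \<lbrakk>connected U; U \<subseteq> {z \<in> ball 0 1. cmod (f z) < M}\<rbrakk> \<Longrightarrow> \<exists>r<1. U \<subseteq> cball 0 r"
    and crit: "\<And>z. \<lbrakk>z \<in> ball 0 1; deriv f z = 0\<rbrakk> \<Longrightarrow> cmod (f z) < M"
    and "0 < M"
  shows "connected {z \<in> ball 0 1. cmod (f z) < M}"
proof -
  define V where "V = (\<lambda>s. {z \<in> ball 0 1. cmod (f z) < s})"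
  have contf: "continuous_on (ball 0 1) f" by (rule holomorphic_on_imp_continuous_on[OF holf])
  have opV: "open (V s)" for s
  proof -
    have "V s = ball 0 1 \<inter> f -` ball 0 s" unfolding V_def by auto
    then show ?thesis by (simp add: continuous_open_preimage contf)
  qed
  have "connected_component (V M) x y" if x: "x \<in> V M" and y: "y \<in> V M" for x y
  proof -
    define J where "J = (\<lambda>s. connected_component (V s) x y)"
    have mono: "J s'" if "J s" "s \<le> s'" for s s'
    proof -
      have "V s \<subseteq> V s'" using that(2) by (auto simp: V_def)
      then show ?thesis using that(1) unfolding J_def by (rule connected_component_of_subset[rotated])
    qed
    \<comment> \<open>A joining path is compact, so the maximum of \<open>cmod (f z)\<close> on it
      is strictly below \<open>s\<close>; any level in between will do.\<close>
    have bounded_path: "\<exists>m<s. J m" if "J s" for s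
    proof -
      have "path_component (V s) x y"
        using that opV[of s] unfolding J_def
        by (metis mem_Collect_eq open_path_connected_component)
      then obtain g where g: "path g" "path_image g \<subseteq> V s" "pathstart g = x" "pathfinish g = y"
        unfolding path_component_def by blast
      have "continuous_on (path_image g) (\<lambda>z. cmod (f z))"
        using g(2) by (intro continuous_on_norm continuous_on_subset[OF contf]) (auto simp: V_def)
      then obtain w where w: "w \<in> path_image g" "\<And>z. z \<in> path_image g \<Longrightarrow> cmod (f z) \<le> cmod (f w)"
        using continuous_attains_sup[of "path_image g" "\<lambda>z. cmod (f z)"] g(1)
        by (metis compact_path_image path_image_nonempty)
      define m where "m = (cmod (f w) + s) / 2"
      have "cmod (f w) < s" using w g(2) by (auto simp: V_def)
      then have "m < s" "cmod (f w) < m" unfolding m_def by auto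
      moreover have "path_image g \<subseteq> V m"
        using g(2) w(2) \<open>cmod (f w) < m\<close> by (force simp: V_def)
      ultimately have "m < s" "J m"
        unfolding J_def connected_component_def
        using g connected_path_image pathstart_in_path_image pathfinish_in_path_image by blast+
      then show ?thesis by blast
    qed
    have ex: "\<exists>s. J s"
    proof -
      have seg: "closed_segment x y \<subseteq> ball 0 1"
        using x y by (intro closed_segment_subset) (auto simp: V_def)
      have "compact (f ` closed_segment x y)"
        by (intro compact_continuous_image continuous_on_subset[OF contf] seg) auto
      then obtain B where B: "\<And>z. z \<in> closed_segment x y \<Longrightarrow> cmod (f z) < B"
        using compact_imp_bounded bounded_pos_less by (metis image_eqI)
      have "J B" unfolding J_def connected_component_def
        by (rule exI[of _ "closed_segment x y"]) (use seg B in \<open>auto simp: V_def\<close>)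
      then show ?thesis ..
    qed
    \<comment> \<open>The components containing \<open>x\<close> at the levels
      \<open>s + 1 / Suc n\<close> decrease, and by \<open>rel\<close> their closures are compact in
      the disc. Their intersection \<open>K\<close> is therefore connected; it contains
      \<open>x\<close> and \<open>y\<close>, and \<open>cmod (f p) \<le> s\<close> on it.\<close>
    have down: "J s" if s: "M \<le> s" and J: "\<And>s'. s < s' \<Longrightarrow> J s'" for s
    proof -
      define C where "C = (\<lambda>n::nat. connected_component_set (V (s + 1 / Suc n)) x)"
      have CV: "C n \<subseteq> V (s + 1 / Suc n)" for n
        unfolding C_def by (rule connected_component_subset)
      have Cr: "\<exists>r<1. C n \<subseteq> cball 0 r" for n
        by (rule rel[of _ "s + 1 / Suc n"]) (use CV[of n] in \<open>auto simp: C_def V_def\<close>)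
      have nest: "C n \<subseteq> C m" if "m \<le> n" for m n
        unfolding C_def
      proof (rule connected_component_mono)
        have "1 / real (Suc n) \<le> 1 / real (Suc m)" using that by (simp add: frac_le)
        then show "V (s + 1 / Suc n) \<subseteq> V (s + 1 / Suc m)" unfolding V_def by force
      qed
      define K where "K = (\<Inter>n. closure (C n))"
      have "compact (closure (C n))" for n
        using Cr[of n] bounded_subset bounded_cball by (metis compact_closure)
      then have conK: "connected K"
        unfolding K_def by (intro connected_nest connected_imp_connected_closure nest closure_mono)
          (auto simp: C_def)
      have xy: "x \<in> K" "y \<in> K"
      proof -
        have "x \<in> C n" "y \<in> C n" for n
        proof -
          have "J (s + 1 / Suc n)" using J by simp
          then show "y \<in> C n" "x \<in> C n" unfolding C_def J_def
            using connected_component_in by (fastforce, fastforce)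
        qed
        then show "x \<in> K" "y \<in> K" unfolding K_def using closure_subset by blast+
      qed
      have Kdisc: "K \<subseteq> ball 0 1"
      proof -
        obtain r where r: "r < 1" "C 0 \<subseteq> cball 0 r" using Cr by blast
        then have "closure (C 0) \<subseteq> cball 0 r" by (simp add: closure_minimal)
        then show ?thesis using r unfolding K_def by force
      qed
      have Kle: "cmod (f p) \<le> s" if "p \<in> K" for p
      proof (rule field_le_epsilon)
        fix e :: real assume "e > 0"
        then obtain n where n: "1 / Suc n < e" using nat_approx_posE by metis
        have pn: "p \<in> closure (C n)" "p \<in> ball 0 1" using that Kdisc by (auto simp: K_def)
        show "cmod (f p) \<le> s + e"
        proof (rule ccontr)
          assume "\<not> ?thesis"
          then have "cmod (f p) > s + 1 / Suc n" using n by linarith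
          moreover have "open (ball 0 1 \<inter> (\<lambda>z. cmod (f z)) -` {s + 1 / Suc n<..})"
            by (intro continuous_open_preimage continuous_on_norm contf) auto
          ultimately have "(ball 0 1 \<inter> (\<lambda>z. cmod (f z)) -` {s + 1 / Suc n<..}) \<inter> C n \<noteq> {}"
            using pn open_Int_closure_eq_empty by blast
          then show False using CV[of n] by (auto simp: V_def)
        qed
      qed
      \<comment> \<open>Points of \<open>K\<close> strictly below level \<open>s\<close> are
        interior to \<open>V s\<close>; points on level \<open>s\<close> are not critical, since
        \<open>M \<le> s\<close>.\<close>
      have loc: "\<exists>N. open N \<and> p \<in> N \<and> connected (N \<inter> V s) \<and> p \<in> closure (V s)" if p: "p \<in> K" for p
      proof (cases "cmod (f p) < s")
        case True
        then have "p \<in> V s" using p Kdisc by (auto simp: V_def)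
        then obtain e where "e > 0" "ball p e \<subseteq> V s" using opV openE by meson
        then show ?thesis
          using \<open>p \<in> V s\<close> closure_subset by (intro exI[of _ "ball p e"]) (auto simp: Int_absorb2)
      next
        case False
        then have "deriv f p \<noteq> 0"
          using crit[of p] p Kdisc s by force
        obtain N where "open N" "p \<in> N" "N \<subseteq> ball 0 1" "connected (N \<inter> {z. cmod (f z) < s})"
            "p \<in> closure {z \<in> ball 0 1. cmod (f z) < s}"
        proof (rule sublevel_set_locally_connected_at[OF holf open_ball _ \<open>deriv f p \<noteq> 0\<close>])
          show "p \<in> ball 0 1" "0 < s" "cmod (f p) \<le> s"
            using p Kdisc Kle[OF p] s \<open>0 < M\<close> by auto
        qed blast
        moreover have "N \<inter> {z. cmod (f z) < s} = N \<inter> V s" using \<open>N \<subseteq> _\<close> by (auto simp: V_def)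
        ultimately show ?thesis unfolding V_def by metis
      qed
      define A where "A = connected_component_set (V s) x"
      have xV: "x \<in> V s" "y \<in> V s" using x y s by (auto simp: V_def)
      show ?thesis
      proof (rule ccontr)
        assume "\<not> J s"
        then have "y \<in> V s - A" using xV by (simp add: A_def J_def)
        moreover have "x \<in> A" using xV by (simp add: A_def)
        ultimately have ne: "closure A \<inter> K \<noteq> {}" "closure (V s - A) \<inter> K \<noteq> {}"
          using xy closure_subset by blast+
        have "V s = A \<union> (V s - A)" unfolding A_def using connected_component_subset by blast
        then have "K \<subseteq> closure A \<union> closure (V s - A)"
          using loc closure_Un by (metis subsetI)
        moreover have "closure A \<inter> closure (V s - A) \<inter> K = {}"
        proof (rule ccontr)
          assume "\<not> ?thesis"
          then obtain p where p: "p \<in> closure A" "p \<in> closure (V s - A)" "p \<in> K" by blast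
          obtain N where N: "open N" "p \<in> N" "connected (N \<inter> V s)" using loc[OF p(3)] by blast
          obtain a where a: "a \<in> N" "a \<in> A"
            using N p open_Int_closure_eq_empty[of N A] by blast
          obtain b where b: "b \<in> N" "b \<in> V s - A"
            using N p open_Int_closure_eq_empty[of N "V s - A"] by blast
          have "connected_component (V s) a b"
            unfolding connected_component_def
            using N a b A_def connected_component_subset[of "V s" x] by blast
          then show False using a b unfolding A_def
            by (metis DiffD2 connected_component_trans mem_Collect_eq)
        qed
        ultimately show False
          using connected_closedD[OF conK, of "closure A" "closure (V s - A)"] ne by simp
      qed
    qed
    define s0 where "s0 = Inf {s. M \<le> s \<and> J s}"
    have ne: "{s. M \<le> s \<and> J s} \<noteq> {}"
      using ex mono by (metis (mono_tags, lifting) empty_iff max.cobounded1 max.cobounded2 mem_Collect_eq)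
    have bdd: "bdd_below {s. M \<le> s \<and> J s}" by (rule bdd_belowI[of _ M]) auto
    have "M \<le> s0" unfolding s0_def by (rule cInf_greatest[OF ne]) auto
    moreover have "J s'" if "s0 < s'" for s'
      using that cInf_lessD[OF ne, of s'] mono unfolding s0_def by force
    ultimately have "J s0" using down by blast
    then obtain m where m: "m < s0" "J m" using bounded_path by blast
    \<comment> \<open>The level \<open>m\<close> may have dropped below \<open>M\<close>, so
      monotonicity is used to return to \<open>max m M\<close>.\<close>
    have "s0 \<le> max m M"
      unfolding s0_def by (rule cInf_lower[OF _ bdd]) (use m mono in auto)
    then have "s0 = M" using m \<open>M \<le> s0\<close> by auto
    then show ?thesis using \<open>J s0\<close> unfolding J_def by simp
  qed
  then show ?thesis
    unfolding connected_iff_connected_component V_def by blast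
qed

section \<open>No infinite limit along the whole circle\<close>

text \<open>The zeros of \<open>f\<close> are finitely many and are divided out by a polynomial
  \<open>P\<close>. The zero-free quotient \<open>h = f / P\<close> is still large near the circle
  because \<open>P\<close> is bounded, so the maximum principle for \<open>1 / h\<close> fails at
  0.\<close>

lemma holomorphic_not_tendsto_infinity_at_circle:
  assumes holf: "f holomorphic_on ball 0 1"
    and lim: "\<And>M. \<exists>r<1. \<forall>z. r < cmod z \<and> cmod z < 1 \<longrightarrow> M \<le> cmod (f z)"
  shows False
proof -
  \<comment> \<open>The limit in a form with a positive radius and the nonstrict bound
    \<open>\<rho> \<le> cmod z\<close>, so that it applies on the circle of radius \<rho>
    itself.\<close>
  have far: "\<exists>\<rho>. 0 < \<rho> \<and> \<rho> < 1 \<and> (\<forall>z. \<rho> \<le> cmod z \<and> cmod z < 1 \<longrightarrow> M \<le> cmod (f z))" for M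
  proof -
    obtain r where r: "r < 1" "\<forall>z. r < cmod z \<and> cmod z < 1 \<longrightarrow> M \<le> cmod (f z)"
      using lim by blast
    show ?thesis
      by (rule exI[of _ "(max r 0 + 1) / 2"]) (use r in \<open>auto simp: field_simps\<close>)
  qed
  have nonconst: "\<not> f constant_on ball 0 1"
  proof
    assume "f constant_on ball 0 1"
    then obtain c where c: "\<And>z. z \<in> ball 0 1 \<Longrightarrow> f z = c"
      unfolding constant_on_def by blast
    obtain \<rho> where \<rho>: "0 < \<rho>" "\<rho> < 1" "\<forall>z. \<rho> \<le> cmod z \<and> cmod z < 1 \<longrightarrow> cmod c + 1 \<le> cmod (f z)"
      using far by blast
    then have "cmod c + 1 \<le> cmod (f (of_real \<rho>))" by simp
    moreover have "f (of_real \<rho>) = c" using c \<rho> by simp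
    ultimately show False by simp
  qed
  obtain r0 where r0: "0 < r0" "r0 < 1" "\<And>z. \<lbrakk>r0 \<le> cmod z; cmod z < 1\<rbrakk> \<Longrightarrow> 1 \<le> cmod (f z)"
    using far by blast
  define Z where "Z = {z \<in> ball 0 1. f z = 0}"
  \<comment> \<open>All zeros lie in a compact subdisc, where a nonconstant holomorphic function has
    only finitely many.\<close>
  have "Z = {z \<in> cball 0 r0. f z = 0}"
    unfolding Z_def using r0 by (force simp: not_le)
  moreover have "finite {z \<in> cball 0 r0. f z = 0}"
    by (rule holomorphic_compact_finite_zeros[OF holf]) (use r0 nonconst in auto)
  ultimately have finZ: "finite Z" by simp
  define n where "n = (\<lambda>z. nat (zorder f z))"
  define P where "P = (\<lambda>w. \<Prod>s\<in>Z. (w - s) ^ n s)"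
  obtain \<beta> where \<beta>: "\<beta> \<in> ball 0 1" "f \<beta> \<noteq> 0"
    using nonconst unfolding constant_on_def by metis
  have freq: "\<exists>\<^sub>F w in at z. f w \<noteq> 0" if "z \<in> ball 0 1" for z
  proof -
    have "\<forall>\<^sub>F w in at z. f w \<noteq> 0 \<and> w \<in> ball 0 1"
      by (rule non_zero_neighbour_alt[OF holf _ _ that \<beta>]) auto
    then show ?thesis
      by (intro eventually_frequently) (auto elim: eventually_mono)
  qed
  have npos: "n z > 0" if "z \<in> Z" for z
    using zorder_pos_iff[OF holf _ _ freq] that unfolding n_def Z_def by simp
  have P0: "P z = 0 \<longleftrightarrow> f z = 0" if "z \<in> ball 0 1" for z
    unfolding P_def using that finZ npos by (auto simp: prod_zero_iff Z_def)
  \<comment> \<open>Equal orders at every point are what makes the quotient of \<open>f\<close> by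
    \<open>P\<close> extend to a holomorphic function without zeros.\<close>
  have zo: "zorder P z = zorder f z" if z: "z \<in> ball 0 1" for z
  proof (cases "z \<in> Z")
    case True
    show ?thesis
    proof (rule zorder_eqI[where S = UNIV])
      let ?g = "\<lambda>w. \<Prod>s\<in>Z - {z}. (w - s) ^ n s"
      show "?g holomorphic_on UNIV" by (intro holomorphic_intros)
      show "?g z \<noteq> 0" using finZ by (auto simp: prod_zero_iff)
      fix w :: complex assume "w \<noteq> z"
      have "int (n z) = zorder f z" using npos[OF True] unfolding n_def by simp
      then show "P w = ?g w * (w - z) powi zorder f z"
        unfolding P_def by (subst prod.remove[OF finZ True]) (simp flip: power_int_of_nat)
    qed auto
  next
    case False
    then have "f z \<noteq> 0" "P z \<noteq> 0" using z P0 by (auto simp: Z_def)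
    moreover have "f analytic_on {z}"
      using holf z analytic_at by blast
    moreover have "P analytic_on {z}"
      unfolding P_def by (intro analytic_intros)
    ultimately show ?thesis by (simp add: zorder_eq_0I)
  qed
  have holP: "P holomorphic_on S" for S
    unfolding P_def by (intro holomorphic_intros)
  obtain h where h: "h holomorphic_on ball 0 1" "\<And>z. z \<in> ball 0 1 \<Longrightarrow> h z \<noteq> 0"
    "\<And>z. z \<in> ball 0 1 \<Longrightarrow> f z = h z * P z"
    using holomorphic_zorder_factorization[OF holf _ _ holP P0 zo] by auto
  have "compact (P ` cball 0 1)"
    by (intro compact_continuous_image holomorphic_on_imp_continuous_on holP) auto
  then obtain B where B: "B > 0" "\<And>z. z \<in> cball 0 1 \<Longrightarrow> cmod (P z) \<le> B"
    by (metis bounded_pos compact_imp_bounded image_eqI)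
  \<comment> \<open>The factor 2 makes \<open>B / M\<close> half of \<open>cmod (1 / h 0)\<close>,
    which contradicts the bound from the maximum principle.\<close>
  define M where "M = 2 * B * cmod (h 0)"
  have M: "M > 0" unfolding M_def using B h(2)[of 0] by simp
  obtain \<rho> where \<rho>: "0 < \<rho>" "\<rho> < 1" "\<And>z. \<lbrakk>\<rho> \<le> cmod z; cmod z < 1\<rbrakk> \<Longrightarrow> M \<le> cmod (f z)"
    using far by blast
  have hol1: "(\<lambda>z. 1 / h z) holomorphic_on ball 0 1"
    using h by (intro holomorphic_intros) auto
  have "cmod (1 / h 0) \<le> B / M"
  proof (rule maximum_modulus_frontier[where S = "ball 0 \<rho>" and f = "\<lambda>z. 1 / h z"])
    show "(\<lambda>z. 1 / h z) holomorphic_on interior (ball 0 \<rho>)"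
      by (rule holomorphic_on_subset[OF hol1]) (use \<rho> in auto)
    show "continuous_on (closure (ball 0 \<rho>)) (\<lambda>z. 1 / h z)"
      by (intro holomorphic_on_imp_continuous_on holomorphic_on_subset[OF hol1]) (use \<rho> in auto)
    fix z :: complex assume "z \<in> frontier (ball 0 \<rho>)"
    then have z: "cmod z = \<rho>" using \<rho> by simp
    then have "M \<le> cmod (h z) * cmod (P z)"
      using \<rho>(3)[of z] h(3)[of z] \<rho>(2) by (simp add: norm_mult)
    also have "\<dots> \<le> cmod (h z) * B"
      using B(2)[of z] z \<rho> by (intro mult_left_mono) auto
    finally have "M \<le> cmod (h z) * B" .
    moreover have "cmod (h z) > 0" using h(2)[of z] z \<rho> by simp
    ultimately show "cmod (1 / h z) \<le> B / M"
      using M by (simp add: norm_divide field_simps)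
  qed (use \<rho> in auto)
  moreover have "B / M = 1 / (2 * cmod (h 0))" "cmod (h 0) > 0"
    unfolding M_def using B h(2)[of 0] by auto
  ultimately show False by (simp add: norm_divide field_simps)
qed

section \<open>Contradiction for a finite value and for the value infinity\<close>

theorem theorem2:
  fixes f :: "complex \<Rightarrow> complex"
  assumes "f \<in> MacLane_class"
    and "bounded (critical_values f)"
  shows "\<not> (\<exists>D a. is_global_tract f D a)"
proof
  assume "\<exists>D a. is_global_tract f D a"
  then obtain D a where D: "is_global_tract f D a" by blast
  have holf: "f holomorphic_on ball 0 1" and nonconst: "\<not> f constant_on ball 0 1"
    using assms(1) by (auto simp: MacLane_class_def)
  show False
  proof (cases a)
    case (Some w)
    have "f z = w" if z: "z \<in> ball 0 1" for z
    proof -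
      have "cmod (f z - w) \<le> 0 + e" if e: "e > 0" for e
      proof -
        obtain \<delta> where \<delta>: "\<delta> > 0" "\<And>u. Some u \<in> chordal_ball (Some w) \<delta> \<Longrightarrow> cmod (u - w) < e"
          using chordal_ball_finite[OF e] by blast
        have "cmod z < 1" using z by simp
        then obtain c where c: "path c" "pathfinish c = pathstart c" "path_image c \<subseteq> ball 0 1 - cball 0 (cmod z)"
            "winding_number c 0 = 1" "\<And>z. z \<in> path_image c \<Longrightarrow> Some (f z) \<in> chordal_ball (Some w) \<delta>"
          using global_tract_loop[OF assms(1) D _ \<delta>(1), of "cmod z"] Some by metis
        \<comment> \<open>The maximum principle is applied on the component of the complement of the
          loop that contains \<open>z\<close>: its frontier lies on the loop, and the winding number
          keeps its closure in the disc.\<close>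
        define U where "U = connected_component_set (- path_image c) z"
        have zU: "z \<in> U" unfolding U_def using c(3) by auto
        have "connected U" "U \<inter> path_image c = {}"
          using connected_component_subset[of "- path_image c" z] by (auto simp: U_def)
        then obtain r where r: "r < 1" "U \<subseteq> cball 0 r"
          using connected_set_inside_loop[OF c(1-4) _ _ zU] by auto
        have clU: "closure U \<subseteq> ball 0 1"
          using closure_minimal[OF r(2)] r(1) by force
        have "frontier U \<subseteq> frontier (- path_image c)"
          unfolding U_def by (rule frontier_of_connected_component_subset)
        also have "\<dots> \<subseteq> path_image c"
          using c(1) by (simp add: frontier_complement frontier_subset_closed closed_path_image)
        finally have fr: "frontier U \<subseteq> path_image c" .
        have "cmod (f z - w) \<le> e"
        proof (rule maximum_modulus_frontier[where f = "\<lambda>z. f z - w"])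
          show "(\<lambda>z. f z - w) holomorphic_on interior U"
            using clU interior_subset closure_subset
            by (intro holomorphic_intros holomorphic_on_subset[OF holf]) blast
          show "continuous_on (closure U) (\<lambda>z. f z - w)"
            by (intro continuous_intros holomorphic_on_imp_continuous_on holomorphic_on_subset[OF holf] clU)
          show "bounded U" using r(2) bounded_cball bounded_subset by blast
          show "cmod (f u - w) \<le> e" if "u \<in> frontier U" for u
            using \<delta>(2) c(5) fr that less_imp_le by blast
        qed (rule zU)
        then show ?thesis by simp
      qed
      then have "cmod (f z - w) \<le> 0" by (rule field_le_epsilon)
      then show ?thesis by simp
    qed
    then show False using nonconst by (auto simp: constant_on_def)
  next
    case None
    \<comment> \<open>A loop around a point of \<open>U\<close> on which \<open>cmod (f z)\<close>
      exceeds \<open>M\<close> cannot meet \<open>U\<close>, so \<open>U\<close> is trapped inside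
      it.\<close>
    have rel: "\<exists>r<1. U \<subseteq> cball 0 r" if U: "connected U" "U \<subseteq> {z \<in> ball 0 1. cmod (f z) < M}" for M U
    proof (cases "U = {}")
      case True
      then show ?thesis by (auto intro: exI[of _ 0])
    next
      case False
      then obtain z where z: "z \<in> U" by blast
      obtain \<delta> where \<delta>: "\<delta> > 0" "\<And>u. Some u \<in> chordal_ball None \<delta> \<Longrightarrow> M < cmod u"
        using chordal_ball_infinity by blast
      have "cmod z < 1" using z U(2) by auto
      then obtain c where c: "path c" "pathfinish c = pathstart c" "path_image c \<subseteq> ball 0 1 - cball 0 (cmod z)"
          "winding_number c 0 = 1" "\<And>z. z \<in> path_image c \<Longrightarrow> Some (f z) \<in> chordal_ball None \<delta>"
        using global_tract_loop[OF assms(1) D _ \<delta>(1), of "cmod z"] None by metis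
      have "U \<inter> path_image c = {}" using c(5) \<delta>(2) U(2) by force
      then show ?thesis using connected_set_inside_loop[OF c(1-4) U(1) _ z] by simp
    qed
    obtain R where R: "R > 0" "\<And>z. \<lbrakk>z \<in> ball 0 1; deriv f z = 0\<rbrakk> \<Longrightarrow> cmod (f z) < R"
    proof -
      obtain R where "R > 0" "\<And>v. v \<in> critical_values f \<Longrightarrow> cmod v < R"
        using assms(2) unfolding bounded_pos_less by blast
      then show thesis by (intro that[of R]) (auto simp: critical_values_def)
    qed
    show False
    proof (rule holomorphic_not_tendsto_infinity_at_circle[OF holf])
      fix M
      \<comment> \<open>The level has to dominate the critical values as well as the prescribed
        bound \<open>M\<close>, which is arbitrary.\<close>
      have "connected {z \<in> ball 0 1. cmod (f z) < max M R}"
        by (rule connected_sublevel_set_above_critical_values[OF holf rel])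
          (use R in \<open>auto simp: less_max_iff_disj\<close>)
      then obtain r where "r < 1" "{z \<in> ball 0 1. cmod (f z) < max M R} \<subseteq> cball 0 r"
        using rel by blast
      then show "\<exists>r<1. \<forall>z. r < cmod z \<and> cmod z < 1 \<longrightarrow> M \<le> cmod (f z)"
        by (intro exI[of _ r]) (force simp: not_le)
    qed
  qed
qed

end
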